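(* Let $(\mathfrak g,[\,,\,],\alpha)$ be a (multiplicative) Hom-Lie algebra over $\mathbb{R}$. For all $x\in\mathfrak g$ the exponential sequence $s\mapsto\widehat{exp}(sx)$ ($s\in\mathbb{R}$) is valued in the Hom-group $G_{seq}(\mathfrak g)$ of formal group-like sequences of $\mathcal{U}\mathfrak g$. Moreover: \begin{enumerate} \item $\widehat{exp}(0x)$ is the unit element $\mathbf{1}\in G_{seq}(\mathfrak g)$. \item For all $s,t\in\mathbb{R}$, $\widehat{exp}(sx)\vee\widehat{exp}(tx)=\alpha(\widehat{exp}((s+t)x))=\widehat{exp}((s+t)\alpha(x))$. \item $S(\widehat{exp}(sx))=\widehat{exp}(-sx)$ is a strict inverse, i.e. $\widehat{exp}(sx)\vee\widehat{exp}(-sx)=\widehat{exp}(-sx)\vee\widehat{exp}(sx)=\mathbf{1}$. \end{enumerate}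
   Context: The ground field is $\mathbb{R}$; $\mathbb{N}=\{0,1,2,\dots\}$. A (multiplicative) Hom-Lie algebra $(\mathfrak g,[\,,\,],\alpha)$ is a vector space with a skew-symmetric bilinear bracket and a linear $\alpha$ with $\alpha([x,y])=[\alpha(x),\alpha(y)]$ and $[\alpha(x),[y,z]]+[\alpha(y),[z,x]]+[\alpha(z),[x,y]]=0$. Trees. For $n\ge 1$, $T_n$ is the set of planar binary rooted trees with $n$ leaves (labelled $1,\dots,n$ left to right); $T_1=\{|\}$. Grafting $\varphi\vee\psi\in T_{p+q}$ joins the roots of $\varphi\in T_p$ (left) and $\psi\in T_q$ (right) to a new root. A leaf weighted $n$-tree is $(\varphi,a)$ with $\varphi\in T_n$, $a\in\mathbb{N}^n$; $B_n$ is the set of these; $(\varphi,a)\vee(\psi,b)=(\varphi\vee\psi,(a,b))$. $B$ is the disjoint union of all $B_n$ and one further element $\mathbf{1}$; $\mathbb{T}$ is the vector space with basis $B$. On $\mathbb{T}$: $\alpha$ is linear, $\alpha(\mathbf{1})=\mathbf{1}$, $\alpha(\varphi,a_1,\dots,a_n)=(\varphi,a_1+1,\dots,a_n+1)$; $\vee$ is bilinear, equal to grafting on weighted trees, with $\varphi\vee\mathbf{1}=\mathbf{1}\vee\varphi=\alpha(\varphi)$, $\mathbf{1}\vee\mathbf{1}=\mathbf{1}$. For $\varphi\in B_n$, $I\subset\{1,\dots,n\}$, $\varphi_I\in B$ is obtained by replacing leaves not in $I$ by $\mathbf{1}$ and evaluating $\vee$ ($\varphi_\emptyset=\mathbf 1$).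 $S$ is linear with $S(\mathbf{1})=\mathbf{1}$, $S(|,a)=-(|,a)$, $S(\varphi\vee\psi)=S(\psi)\vee S(\varphi)$. $\mathcal{I}\subset\mathbb{T}$ is the two-sided ideal for $\vee$ generated by all $(\phi\vee\psi)\vee\alpha(\chi)-\alpha(\phi)\vee(\psi\vee\chi)$, $\phi,\psi,\chi\in B$. Universal enveloping algebra. Writing $B_n$ also for its linear span, $\mathbb{T}^{\mathfrak g}=\mathbb{R}\mathbf{1}\oplus\bigoplus_{n\ge1}B_n\otimes\mathfrak g^{\otimes n}$, with operations: $(\varphi\otimes x)\vee(\psi\otimes y)=(\varphi\vee\psi)\otimes(x\otimes y)$; $\alpha(\varphi\otimes x)=\alpha(\varphi)\otimes x$, $\alpha(\mathbf 1)=\mathbf 1$; $\mathbf 1\vee w=w\vee\mathbf 1=\alpha(w)$; $\Delta(\varphi\otimes x_1\otimes\cdots\otimes x_n)=\sum_{I\sqcup J=\{1,\dots,n\}}(\varphi_I\otimes x_I)\otimes(\varphi_J\otimes x_J)$ ($x_I$ is the tensor product of the $x_i$, $i\in I$, in increasing order), $\Delta(\mathbf 1)=\mathbf 1\otimes\mathbf 1$; $\epsilon(\mathbf 1)=1$, $\epsilon=0$ on $B_n\otimes\mathfrak g^{\otimes n}$; $S(\varphi\otimes x_1\otimes\cdots\otimes x_n)=S(\varphi)\otimes x_n\otimes\cdots\otimes x_1$, $S(\mathbf 1)=\mathbf 1$. Let $\mathcal{I}^{\mathfrak g}=\bigoplus_{n\ge3}(\mathcal{I}\cap B_n)\otimes\mathfrak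 g^{\otimes n}$, and let $\mathcal{J}^{\mathfrak g}$ be the two-sided ideal of $\mathbb{T}^{\mathfrak g}/\mathcal{I}^{\mathfrak g}$ generated by $(|,n)\otimes x-(|,0)\otimes\alpha^n(x)$ and $\big((|,0)\vee(|,0)\big)\otimes(x\otimes y-y\otimes x)-(|,0)\otimes[x,y]$ for $x,y\in\mathfrak g$, $n\in\mathbb N$. The universal enveloping algebra $\mathcal{U}\mathfrak g$ is the quotient of $\mathbb{T}^{\mathfrak g}/\mathcal{I}^{\mathfrak g}$ by $\mathcal{J}^{\mathfrak g}$ with the induced operations $\vee,\alpha,\mathbf 1,\Delta,\epsilon,S$. Formal group-like sequences. Let $A=\mathcal U\mathfrak g$; extend the operations to $A[\nu]$ by linearity in the formal parameter $\nu$. The invertibility index of $y\in A[\nu]$ is the smallest $k\in\mathbb N$ with $\alpha^k\circ\vee\circ(S\otimes\mathrm{id})\circ\Delta(y)=\alpha^k\circ\vee\circ(\mathrm{id}\otimes S)\circ\Delta(y)=\epsilon(y)\mathbf 1$. A $p$-order group-like element is $g(\nu)\in A[\nu]$ with $\Delta(g(\nu))=g(\nu)\otimes g(\nu)$ modulo $\nu^{p+1}$ and $\epsilon(g(\nu))=1$. $G_{seq}(\mathfrak g)=G_{seq}(\mathcal U\mathfrak g)$ is the set of formal group-like sequences: sequences $(g_p(\nu))_{p\in\mathbb{N}}$ in $A[\nu]$ such that (a) for $p\ge1$, $g_p(\nu)$ is a $p$-order group-like element; (b) $g_{p+1}(\nu)=\alpha(g_p(\nu))$ modulo $\nu^{p+1}$;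 (c) the invertibility indexes of the $g_p(\nu)$ are bounded independently of $p$. Operations $\vee,\alpha,S,\mathbf 1$ on sequences are termwise, and the $p$-th terms are compared modulo $\nu^{p+1}$; with inverse $S$ this is a Hom-group (i.e. $\vee$ is Hom-associative for $\alpha$ with unit $\mathbf 1$, meaning $g\vee\mathbf 1=\mathbf 1\vee g=\alpha(g)$, and for each $g$ there is $k$ with $\alpha^k(g\vee S(g))=\alpha^k(S(g)\vee g)=\mathbf 1$). Exponential. For $\varphi\in T_i$ and $p\ge i$, $\varphi[p]$ is the leaf weighted tree in which leaf $j$ has weight $p-\ell(j)$, where $\ell(j)$ is the number of edges (including the root edge) on the path from the root to leaf $j$ (so $\ell=1$ for the $1$-tree). The class $\lfloor e^i\rfloor_p$ of $\varphi[p]$ in $\mathbb{T}/\mathcal{I}$ does not depend on $\varphi\in T_i$. For $x\in\mathfrak g$, $\lfloor x^i\rfloor_p\in\mathcal U\mathfrak g$ is the class of $\varphi[p]\otimes x^{\otimes i}$, $\varphi\in T_i$. For $s\in\mathbb{R}$, $\widehat{exp}(sx)=(\widehat{exp}_p(sx))_{p\in\mathbb N}$ with $\widehat{exp}_p(sx)=\mathbf 1+\sum_{i=1}^p\frac{s^i}{i!}\nu^i\lfloor x^i\rfloor_p$. *)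

theory Defs
  imports
    "HOL-Analysis.Analysis"
    "HOL-Analysis.Finite_Function_Topology"
    "HOL-Library.Extended_Nat"
    "HOL-Computational_Algebra.Polynomial"
begin

section \<open>Hom-Lie algebras\<close>

text \<open>
  The carrier is a whole type.  Hom-Lie algebras are treated as a type class so that the universal
  enveloping algebra can be a type.
\<close>

class hom_lie_algebra = real_vector +
  fixes hbracket :: "'a \<Rightarrow> 'a \<Rightarrow> 'a"
    and htwist :: "'a \<Rightarrow> 'a"
  assumes htwist_add: "htwist (x + y) = htwist x + htwist y"
    and htwist_scaleR: "htwist (scaleR r x) = scaleR r (htwist x)"
    and hbracket_add_left: "hbracket (x + y) z = hbracket x z + hbracket y z"
    and hbracket_scaleR_left: "hbracket (scaleR r x) z = scaleR r (hbracket x z)"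
    and hbracket_add_right: "hbracket z (x + y) = hbracket z x + hbracket z y"
    and hbracket_scaleR_right: "hbracket z (scaleR r x) = scaleR r (hbracket z x)"
    and hbracket_skew: "hbracket x y = - hbracket y x"
    and htwist_hbracket: "htwist (hbracket x y) = hbracket (htwist x) (htwist y)"
    and hom_jacobi: "hbracket (htwist x) (hbracket y z) + hbracket (htwist y) (hbracket z x)
                       + hbracket (htwist z) (hbracket x y) = 0"


section \<open>Linear algebra: free spaces, quotients, ideals, tensor products\<close>

text \<open>
  \<^typ>\<open>'b \<Rightarrow>\<^sub>0 real\<close> (finitely supported functions) is the real vector space with basis \<^typ>\<open>'b\<close>.
\<close>

definition basis_vec :: "'b \<Rightarrow> ('b \<Rightarrow>\<^sub>0 real)"
  where "basis_vec b = Poly_Mapping.single b 1"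

definition lin_ext :: "('b \<Rightarrow> 'v) \<Rightarrow> ('b \<Rightarrow>\<^sub>0 real) \<Rightarrow> 'v::real_vector"
  where "lin_ext f p = (\<Sum>b\<in>Poly_Mapping.keys p. Poly_Mapping.lookup p b *\<^sub>R f b)"

definition bilin_ext :: "('b \<Rightarrow> 'c \<Rightarrow> 'v) \<Rightarrow> ('b \<Rightarrow>\<^sub>0 real) \<Rightarrow> ('c \<Rightarrow>\<^sub>0 real) \<Rightarrow> 'v::real_vector"
  where "bilin_ext f p q = lin_ext (\<lambda>b. lin_ext (f b) q) p"

definition eq_modulo :: "'v::real_vector set \<Rightarrow> 'v \<Rightarrow> 'v \<Rightarrow> bool"
  where "eq_modulo W u v \<longleftrightarrow> u - v \<in> W"

lemma eq_modulo_equivp: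
  assumes W: "subspace W"
  shows "equivp (eq_modulo W)"
proof (rule equivpI)
  show "reflp (eq_modulo W)"
    using W by (simp add: reflp_def eq_modulo_def subspace_0)
  show "symp (eq_modulo W)"
  proof (rule sympI)
    fix u v assume "eq_modulo W u v"
    then show "eq_modulo W v u"
      using subspace_neg[OF W, of "u - v"] by (simp add: eq_modulo_def)
  qed
  show "transp (eq_modulo W)"
  proof (rule transpI)
    fix u v w assume "eq_modulo W u v" "eq_modulo W v w"
    then show "eq_modulo W u w"
      using subspace_add[OF W, of "u - v" "v - w"] by (simp add: eq_modulo_def)
  qed
qed

lemma eq_modulo_add:
  assumes "subspace W" "eq_modulo W u u'" "eq_modulo W v v'"
  shows "eq_modulo W (u + v) (u' + v')"
  using assms subspace_add[of W "u - u'" "v - v'"] by (simp add: eq_modulo_def algebra_simps)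

lemma eq_modulo_diff:
  assumes "subspace W" "eq_modulo W u u'" "eq_modulo W v v'"
  shows "eq_modulo W (u - v) (u' - v')"
  using assms subspace_diff[of W "u - u'" "v - v'"] by (simp add: eq_modulo_def algebra_simps)

lemma eq_modulo_minus:
  assumes "subspace W" "eq_modulo W u u'"
  shows "eq_modulo W (- u) (- u')"
  using assms subspace_neg[of W "u - u'"] by (simp add: eq_modulo_def)

lemma eq_modulo_scaleR:
  assumes "subspace W" "eq_modulo W u u'"
  shows "eq_modulo W (r *\<^sub>R u) (r *\<^sub>R u')"
  using assms subspace_scale[of W "u - u'" r] by (simp add: eq_modulo_def scaleR_diff_right)

lemma eq_modulo_refl: "subspace W \<Longrightarrow> u = v \<Longrightarrow> eq_modulo W u v"
  by (simp add: eq_modulo_def subspace_0)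

definition two_sided_ideal :: "('v \<Rightarrow> 'v \<Rightarrow> 'v) \<Rightarrow> 'v::real_vector set \<Rightarrow> bool"
  where "two_sided_ideal m I \<longleftrightarrow> subspace I \<and> (\<forall>a. \<forall>w\<in>I. m a w \<in> I \<and> m w a \<in> I)"

definition ideal_generated :: "('v \<Rightarrow> 'v \<Rightarrow> 'v) \<Rightarrow> 'v::real_vector set \<Rightarrow> 'v set"
  where "ideal_generated m G = two_sided_ideal m hull G"

lemma subspace_ideal_generated: "subspace (ideal_generated m G)"
  unfolding ideal_generated_def hull_def two_sided_ideal_def by (rule subspace_Inter) auto


text \<open>The tensor product of two real vector spaces: pairs modulo bilinearity.\<close>

definition tensor_relations :: "('a::real_vector \<times> 'b::real_vector \<Rightarrow>\<^sub>0 real) set"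
  where "tensor_relations =
     {basis_vec (a + a', b) - basis_vec (a, b) - basis_vec (a', b) | a a' b. True}
   \<union> {basis_vec (a, b + b') - basis_vec (a, b) - basis_vec (a, b') | a b b'. True}
   \<union> {basis_vec (r *\<^sub>R a, b) - r *\<^sub>R basis_vec (a, b) | r a b. True}
   \<union> {basis_vec (a, r *\<^sub>R b) - r *\<^sub>R basis_vec (a, b) | r a b. True}"

quotient_type (overloaded) ('a, 'b) tensor =
    "('a::real_vector \<times> 'b::real_vector) \<Rightarrow>\<^sub>0 real" / "eq_modulo (span tensor_relations)"
  by (rule eq_modulo_equivp) (rule subspace_span)

instantiation tensor :: (real_vector, real_vector) real_vector
begin

lift_definition zero_tensor :: "('a, 'b) tensor" is 0 .
lift_definition plus_tensor :: "('a, 'b) tensor \<Rightarrow> ('a, 'b) tensor \<Rightarrow> ('a, 'b) tensor" is "(+)"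
  by (intro eq_modulo_add subspace_span)
lift_definition minus_tensor :: "('a, 'b) tensor \<Rightarrow> ('a, 'b) tensor \<Rightarrow> ('a, 'b) tensor" is "(-)"
  by (intro eq_modulo_diff subspace_span)
lift_definition uminus_tensor :: "('a, 'b) tensor \<Rightarrow> ('a, 'b) tensor" is uminus
  by (intro eq_modulo_minus subspace_span)
lift_definition scaleR_tensor :: "real \<Rightarrow> ('a, 'b) tensor \<Rightarrow> ('a, 'b) tensor" is scaleR
  by (intro eq_modulo_scaleR subspace_span)

instance
  by standard (transfer, rule eq_modulo_refl[OF subspace_span], simp add: algebra_simps)+

end

definition tensor :: "'a::real_vector \<Rightarrow> 'b::real_vector \<Rightarrow> ('a, 'b) tensor"  (infixr \<open>\<otimes>\<close> 70)
  where "a \<otimes> b = abs_tensor (basis_vec (a, b))"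

text \<open>For bilinear \<open>f\<close>, the linear map with \<open>a \<otimes> b \<mapsto> f a b\<close>.\<close>

definition tensor_lift :: "('a \<Rightarrow> 'b \<Rightarrow> 'v) \<Rightarrow> ('a::real_vector, 'b::real_vector) tensor \<Rightarrow> 'v::real_vector"
  where "tensor_lift f t = lin_ext (\<lambda>(a, b). f a b) (rep_tensor t)"

definition tensor_map ::
  "('a \<Rightarrow> 'c) \<Rightarrow> ('b \<Rightarrow> 'd) \<Rightarrow> ('a::real_vector, 'b::real_vector) tensor
     \<Rightarrow> ('c::real_vector, 'd::real_vector) tensor"
  where "tensor_map f h = tensor_lift (\<lambda>a b. f a \<otimes> h b)"


section \<open>Trees\<close>

datatype tree = Tip | Fork tree tree

primrec num_tips :: "tree \<Rightarrow> nat" where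
  "num_tips Tip = 1"
| "num_tips (Fork l r) = num_tips l + num_tips r"

definition trees :: "nat \<Rightarrow> tree set"
  where "trees n = {\<phi>. num_tips \<phi> = n}"

text \<open>
  Planar binary trees whose leaves carry a weight and an element of \<open>'x\<close>, listed from left to right.
  The leaf weighted trees of the set \<open>B\<^sub>n\<close> are the trees of type \<open>unit wtree\<close> with \<open>n\<close> leaves;
  trees of type \<open>'g wtree\<close> are the pure tensors \<open>\<phi> \<otimes> x\<^sub>1 \<otimes> \<dots> \<otimes> x\<^sub>n\<close> with \<open>\<phi> \<in> B\<^sub>n\<close>, the factor
  \<open>x\<^sub>j\<close> being attached to the leaf \<open>j\<close>.
\<close>

datatype 'x wtree = Leaf nat 'x | Graft "'x wtree" "'x wtree"

primrec num_leaves :: "'x wtree \<Rightarrow> nat" where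
  "num_leaves (Leaf a x) = 1"
| "num_leaves (Graft l r) = num_leaves l + num_leaves r"

primrec shift :: "'x wtree \<Rightarrow> 'x wtree" where
  "shift (Leaf a x) = Leaf (Suc a) x"
| "shift (Graft l r) = Graft (shift l) (shift r)"

text \<open>
  \<open>decorate \<phi> [x\<^sub>1, \<dots>, x\<^sub>n]\<close> is \<open>\<phi> \<otimes> x\<^sub>1 \<otimes> \<dots> \<otimes> x\<^sub>n\<close>; only used for lists of length \<open>num_leaves \<phi>\<close>.
\<close>

primrec decorate :: "unit wtree \<Rightarrow> 'x list \<Rightarrow> 'x wtree" where
  "decorate (Leaf a u) xs = Leaf a (hd xs)"
| "decorate (Graft l r) xs =
     Graft (decorate l (take (num_leaves l) xs)) (decorate r (drop (num_leaves l) xs))"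

text \<open>In \<^typ>\<open>'x wtree option\<close> the element \<^const>\<open>None\<close> is the additional element \<open>\<one>\<close>.\<close>

fun graft_basis :: "'x wtree option \<Rightarrow> 'x wtree option \<Rightarrow> 'x wtree option" where
  "graft_basis (Some l) (Some r) = Some (Graft l r)"
| "graft_basis None w = map_option shift w"
| "graft_basis w None = map_option shift w"

text \<open>
  \<open>prune I \<phi>\<close> is \<open>\<phi>\<^sub>I\<close>, for \<open>I \<subseteq> {1..num_leaves \<phi>}\<close>.  Leaf \<open>i\<close> of the right subtree is leaf
  \<open>i + num_leaves l\<close> of the whole tree.
\<close>

fun prune :: "nat set \<Rightarrow> 'x wtree \<Rightarrow> 'x wtree option" where
  "prune I (Leaf a x) = (if 1 \<in> I then Some (Leaf a x) else None)"
| "prune I (Graft l r) = graft_basis (prune I l) (prune {i. i + num_leaves l \<in> I} r)"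

text \<open>
  \<open>unit forest\<close> is the space \<open>\<T>\<close>; \<open>'g forest\<close> consists of the formal linear combinations of
  pure tensors whose quotient by multilinearity is \<open>\<T>\<^sup>\<gg>\<close> (see \<open>tens\<close> below).
  In both cases the structure maps are given by the same formulas.
\<close>

type_synonym 'x forest = "'x wtree option \<Rightarrow>\<^sub>0 real"

definition vee :: "'x forest \<Rightarrow> 'x forest \<Rightarrow> 'x forest"
  where "vee = bilin_ext (\<lambda>a b. basis_vec (graft_basis a b))"

definition alpha :: "'x forest \<Rightarrow> 'x forest"
  where "alpha = lin_ext (\<lambda>b. basis_vec (map_option shift b))"

definition comult :: "'x forest \<Rightarrow> ('x forest, 'x forest) tensor"
  where "comult = lin_ext (\<lambda>b. case b of
     None \<Rightarrow> basis_vec None \<otimes> basis_vec None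
   | Some t \<Rightarrow> (\<Sum>I\<in>Pow {1..num_leaves t}.
        basis_vec (prune I t) \<otimes> basis_vec (prune ({1..num_leaves t} - I) t)))"

definition counit :: "'x forest \<Rightarrow> real"
  where "counit p = Poly_Mapping.lookup p None"

primrec antipode_wtree :: "'x wtree \<Rightarrow> 'x forest" where
  "antipode_wtree (Leaf a x) = - basis_vec (Some (Leaf a x))"
| "antipode_wtree (Graft l r) = vee (antipode_wtree r) (antipode_wtree l)"

definition antipode :: "'x forest \<Rightarrow> 'x forest"
  where "antipode = lin_ext (\<lambda>b. case b of None \<Rightarrow> basis_vec None | Some t \<Rightarrow> antipode_wtree t)"

definition hom_assoc_ideal :: "unit forest set"
  where "hom_assoc_ideal = ideal_generated vee
     {vee (vee (basis_vec \<phi>) (basis_vec \<psi>)) (alpha (basis_vec \<rho>))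
       - vee (alpha (basis_vec \<phi>)) (vee (basis_vec \<psi>) (basis_vec \<rho>)) | \<phi> \<psi> \<rho>. True}"

text \<open>The linear span of \<open>B\<^sub>n\<close>.\<close>

definition B_span :: "nat \<Rightarrow> unit forest set"
  where "B_span n = span {basis_vec (Some \<phi>) | \<phi>. num_leaves \<phi> = n}"


section \<open>The universal enveloping algebra\<close>

text \<open>
  \<open>tens\<close> is \<open>\<T>\<^sup>\<gg>\<close>, where \<open>B\<^sub>n \<otimes> \<gg>\<^sup>\<otimes>\<^sup>n\<close> is the space generated by the
  \<open>\<phi> \<otimes> x\<^sub>1 \<otimes> \<dots> \<otimes> x\<^sub>n\<close>, \<open>\<phi>\<close> in the basis \<open>B\<^sub>n\<close>, modulo multilinearity in the \<open>x\<^sub>j\<close>.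
\<close>

definition multilinear_relations :: "'g::real_vector forest set"
  where "multilinear_relations =
     {basis_vec (Some (decorate \<phi> (xs @ (x + y) # ys)))
        - basis_vec (Some (decorate \<phi> (xs @ x # ys)))
        - basis_vec (Some (decorate \<phi> (xs @ y # ys)))
        | \<phi> xs x y ys. length xs + 1 + length ys = num_leaves \<phi>}
   \<union> {basis_vec (Some (decorate \<phi> (xs @ (r *\<^sub>R x) # ys)))
        - r *\<^sub>R basis_vec (Some (decorate \<phi> (xs @ x # ys)))
        | \<phi> xs r x ys. length xs + 1 + length ys = num_leaves \<phi>}"

quotient_type (overloaded) 'g tens = "'g::real_vector forest" / "eq_modulo (span multilinear_relations)"
  by (rule eq_modulo_equivp) (rule subspace_span)

instantiation tens :: (real_vector) real_vector
begin

lift_definition zero_tens :: "'a tens" is 0 .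
lift_definition plus_tens :: "'a tens \<Rightarrow> 'a tens \<Rightarrow> 'a tens" is "(+)"
  by (intro eq_modulo_add subspace_span)
lift_definition minus_tens :: "'a tens \<Rightarrow> 'a tens \<Rightarrow> 'a tens" is "(-)"
  by (intro eq_modulo_diff subspace_span)
lift_definition uminus_tens :: "'a tens \<Rightarrow> 'a tens" is uminus
  by (intro eq_modulo_minus subspace_span)
lift_definition scaleR_tens :: "real \<Rightarrow> 'a tens \<Rightarrow> 'a tens" is scaleR
  by (intro eq_modulo_scaleR subspace_span)

instance
  by standard (transfer, rule eq_modulo_refl[OF subspace_span], simp add: algebra_simps)+

end

text \<open>
  The structure maps respect the relations imposed here and below, so the choice of representative in
  the induced maps (given by \<open>rep_\<close>, followed by the projection \<open>abs_\<close>) is immaterial.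
\<close>

definition vee_tens :: "'g::real_vector tens \<Rightarrow> 'g tens \<Rightarrow> 'g tens"
  where "vee_tens u v = abs_tens (vee (rep_tens u) (rep_tens v))"

text \<open>The element \<open>p \<otimes> x\<^sub>1 \<otimes> \<dots> \<otimes> x\<^sub>n\<close> for \<open>p\<close> in the span of \<open>B\<^sub>n\<close>.\<close>

definition pure_tens :: "unit forest \<Rightarrow> 'g list \<Rightarrow> 'g::real_vector tens"
  where "pure_tens p xs = abs_tens (lin_ext (\<lambda>b. basis_vec (map_option (\<lambda>\<phi>. decorate \<phi> xs) b)) p)"

definition tens_hom_assoc_ideal :: "'g::real_vector tens set"
  where "tens_hom_assoc_ideal =
     span {pure_tens p xs | p xs. length xs \<ge> 3 \<and> p \<in> hom_assoc_ideal \<inter> B_span (length xs)}"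

text \<open>The quotient of \<open>\<T>\<^sup>\<gg>\<close> by \<open>\<I>\<^sup>\<gg>\<close>.\<close>

quotient_type (overloaded) 'g free_uea = "'g::real_vector tens" / "eq_modulo tens_hom_assoc_ideal"
  unfolding tens_hom_assoc_ideal_def by (rule eq_modulo_equivp) (rule subspace_span)

lemma subspace_tens_hom_assoc_ideal: "subspace tens_hom_assoc_ideal"
  unfolding tens_hom_assoc_ideal_def by (rule subspace_span)

instantiation free_uea :: (real_vector) real_vector
begin

lift_definition zero_free_uea :: "'a free_uea" is 0 .
lift_definition plus_free_uea :: "'a free_uea \<Rightarrow> 'a free_uea \<Rightarrow> 'a free_uea" is "(+)"
  by (intro eq_modulo_add subspace_tens_hom_assoc_ideal)
lift_definition minus_free_uea :: "'a free_uea \<Rightarrow> 'a free_uea \<Rightarrow> 'a free_uea" is "(-)"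
  by (intro eq_modulo_diff subspace_tens_hom_assoc_ideal)
lift_definition uminus_free_uea :: "'a free_uea \<Rightarrow> 'a free_uea" is uminus
  by (intro eq_modulo_minus subspace_tens_hom_assoc_ideal)
lift_definition scaleR_free_uea :: "real \<Rightarrow> 'a free_uea \<Rightarrow> 'a free_uea" is scaleR
  by (intro eq_modulo_scaleR subspace_tens_hom_assoc_ideal)

instance
  by standard
    (transfer, rule eq_modulo_refl[OF subspace_tens_hom_assoc_ideal], simp add: algebra_simps)+

end

definition vee_free_uea :: "'g::real_vector free_uea \<Rightarrow> 'g free_uea \<Rightarrow> 'g free_uea"
  where "vee_free_uea u v = abs_free_uea (vee_tens (rep_free_uea u) (rep_free_uea v))"

definition pure_free_uea :: "unit wtree \<Rightarrow> 'g list \<Rightarrow> 'g::real_vector free_uea"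
  where "pure_free_uea \<phi> xs = abs_free_uea (pure_tens (basis_vec (Some \<phi>)) xs)"

definition uea_ideal :: "'g::hom_lie_algebra free_uea set"
  where "uea_ideal = ideal_generated vee_free_uea
     ({pure_free_uea (Leaf n ()) [x] - pure_free_uea (Leaf 0 ()) [(htwist ^^ n) x] | n x. True}
    \<union> {pure_free_uea (Graft (Leaf 0 ()) (Leaf 0 ())) [x, y]
         - pure_free_uea (Graft (Leaf 0 ()) (Leaf 0 ())) [y, x]
         - pure_free_uea (Leaf 0 ()) [hbracket x y] | x y. True})"

lemma subspace_uea_ideal: "subspace uea_ideal"
  unfolding uea_ideal_def by (rule subspace_ideal_generated)

quotient_type (overloaded) 'g uea = "'g::hom_lie_algebra free_uea" / "eq_modulo uea_ideal"
  by (rule eq_modulo_equivp) (rule subspace_uea_ideal)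

instantiation uea :: (hom_lie_algebra) real_vector
begin

lift_definition zero_uea :: "'a uea" is 0 .
lift_definition plus_uea :: "'a uea \<Rightarrow> 'a uea \<Rightarrow> 'a uea" is "(+)"
  by (intro eq_modulo_add subspace_uea_ideal)
lift_definition minus_uea :: "'a uea \<Rightarrow> 'a uea \<Rightarrow> 'a uea" is "(-)"
  by (intro eq_modulo_diff subspace_uea_ideal)
lift_definition uminus_uea :: "'a uea \<Rightarrow> 'a uea" is uminus
  by (intro eq_modulo_minus subspace_uea_ideal)
lift_definition scaleR_uea :: "real \<Rightarrow> 'a uea \<Rightarrow> 'a uea" is scaleR
  by (intro eq_modulo_scaleR subspace_uea_ideal)

instance
  by standard (transfer, rule eq_modulo_refl[OF subspace_uea_ideal], simp add: algebra_simps)+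

end

definition uea_class :: "'g::hom_lie_algebra forest \<Rightarrow> 'g uea"
  where "uea_class p = abs_uea (abs_free_uea (abs_tens p))"

definition uea_rep :: "'g::hom_lie_algebra uea \<Rightarrow> 'g forest"
  where "uea_rep u = rep_tens (rep_free_uea (rep_uea u))"

definition uea_unit :: "'g::hom_lie_algebra uea"
  where "uea_unit = uea_class (basis_vec None)"

definition uea_vee :: "'g::hom_lie_algebra uea \<Rightarrow> 'g uea \<Rightarrow> 'g uea"
  where "uea_vee u v = uea_class (vee (uea_rep u) (uea_rep v))"

definition uea_alpha :: "'g::hom_lie_algebra uea \<Rightarrow> 'g uea"
  where "uea_alpha u = uea_class (alpha (uea_rep u))"

definition uea_comult :: "'g::hom_lie_algebra uea \<Rightarrow> ('g uea, 'g uea) tensor"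
  where "uea_comult u = tensor_map uea_class uea_class (comult (uea_rep u))"

definition uea_counit :: "'g::hom_lie_algebra uea \<Rightarrow> real"
  where "uea_counit u = counit (uea_rep u)"

definition uea_antipode :: "'g::hom_lie_algebra uea \<Rightarrow> 'g uea"
  where "uea_antipode u = uea_class (antipode (uea_rep u))"


section \<open>Formal group-like sequences\<close>

text \<open>
  \<open>A[\<nu>]\<close> is \<^typ>\<open>'a poly\<close>.  Linear operations are extended to it by \<^const>\<open>map_poly\<close>, bilinear ones by
  \<open>poly_bilin\<close>; in particular \<open>poly_bilin (\<otimes>)\<close> takes values in \<open>(A \<otimes> A)[\<nu>]\<close>.
\<close>

definition poly_bilin :: "('a \<Rightarrow> 'b \<Rightarrow> 'c) \<Rightarrow> 'a::zero poly \<Rightarrow> 'b::zero poly \<Rightarrow> 'c::comm_monoid_add poly"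
  where "poly_bilin m f h =
     (\<Sum>i\<le>degree f. \<Sum>j\<le>degree h. monom (m (coeff f i) (coeff h j)) (i + j))"

text \<open>Equality modulo \<open>\<nu>\<^sup>n\<close>.\<close>

definition eq_mod_nu :: "nat \<Rightarrow> 'a::zero poly \<Rightarrow> 'a poly \<Rightarrow> bool"
  where "eq_mod_nu n f h \<longleftrightarrow> (\<forall>k<n. coeff f k = coeff h k)"

definition invertible_at :: "nat \<Rightarrow> 'g::hom_lie_algebra uea poly \<Rightarrow> bool"
  where "invertible_at k y \<longleftrightarrow>
     map_poly ((uea_alpha ^^ k) \<circ> tensor_lift uea_vee \<circ> tensor_map uea_antipode id \<circ> uea_comult) y
       = map_poly (\<lambda>u. uea_counit u *\<^sub>R uea_unit) y
   \<and> map_poly ((uea_alpha ^^ k) \<circ> tensor_lift uea_vee \<circ> tensor_map id uea_antipode \<circ> uea_comult) y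
       = map_poly (\<lambda>u. uea_counit u *\<^sub>R uea_unit) y"

text \<open>The smallest such \<open>k\<close>, and \<open>\<infinity>\<close> if there is none.\<close>

definition invertibility_index :: "'g::hom_lie_algebra uea poly \<Rightarrow> enat"
  where "invertibility_index y = (INF k\<in>{k. invertible_at k y}. enat k)"

definition group_like :: "nat \<Rightarrow> 'g::hom_lie_algebra uea poly \<Rightarrow> bool"
  where "group_like p h \<longleftrightarrow>
     eq_mod_nu (p + 1) (map_poly uea_comult h) (poly_bilin (\<otimes>) h h)
   \<and> map_poly uea_counit h = 1"

definition G_seq :: "(nat \<Rightarrow> 'g::hom_lie_algebra uea poly) set"
  where "G_seq = {h.
     (\<forall>p\<ge>1. group_like p (h p))
   \<and> (\<forall>p. eq_mod_nu (p + 1) (h (p + 1)) (map_poly uea_alpha (h p)))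
   \<and> (\<exists>K::nat. \<forall>p. invertibility_index (h p) \<le> enat K)}"

text \<open>Equality in \<^const>\<open>G_seq\<close>: the \<open>p\<close>-th terms are compared modulo \<open>\<nu>\<^sup>p\<^sup>+\<^sup>1\<close>.\<close>

definition seq_eq ::
  "(nat \<Rightarrow> 'g::hom_lie_algebra uea poly) \<Rightarrow> (nat \<Rightarrow> 'g uea poly) \<Rightarrow> bool"  (infix \<open>\<doteq>\<close> 50)
  where "f \<doteq> h \<longleftrightarrow> (\<forall>p. eq_mod_nu (p + 1) (f p) (h p))"

definition seq_unit :: "nat \<Rightarrow> 'g::hom_lie_algebra uea poly"
  where "seq_unit = (\<lambda>p. [:uea_unit:])"

definition seq_vee ::
  "(nat \<Rightarrow> 'g::hom_lie_algebra uea poly) \<Rightarrow> (nat \<Rightarrow> 'g uea poly) \<Rightarrow> (nat \<Rightarrow> 'g uea poly)"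
    (infixl \<open>\<squnion>\<^sub>G\<close> 65)
  where "f \<squnion>\<^sub>G h = (\<lambda>p. poly_bilin uea_vee (f p) (h p))"

definition seq_alpha :: "(nat \<Rightarrow> 'g::hom_lie_algebra uea poly) \<Rightarrow> (nat \<Rightarrow> 'g uea poly)"
  where "seq_alpha f = (\<lambda>p. map_poly uea_alpha (f p))"

definition seq_antipode :: "(nat \<Rightarrow> 'g::hom_lie_algebra uea poly) \<Rightarrow> (nat \<Rightarrow> 'g uea poly)"
  where "seq_antipode f = (\<lambda>p. map_poly uea_antipode (f p))"


section \<open>The exponential sequence\<close>

text \<open>
  \<open>weigh p d \<phi>\<close> gives a leaf of \<open>\<phi>\<close> the weight \<open>p - d - e\<close>, where \<open>e\<close> is the number of edges
  between it and the top of \<open>\<phi>\<close>.  For \<open>\<phi>[p]\<close> the root edge is counted as well, hence \<open>d = 1\<close>.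
  The subtraction does not truncate for \<open>p \<ge> num_tips \<phi>\<close>.
\<close>

fun weigh :: "nat \<Rightarrow> nat \<Rightarrow> tree \<Rightarrow> unit wtree" where
  "weigh p d Tip = Leaf (p - d) ()"
| "weigh p d (Fork l r) = Graft (weigh p (d + 1) l) (weigh p (d + 1) r)"

text \<open>
  The class \<open>\<lfloor>x\<^sup>i\<rfloor>\<^sub>p\<close> of \<open>\<phi>[p] \<otimes> x \<otimes> \<dots> \<otimes> x\<close>, which does not depend on the choice of
  \<open>\<phi> \<in> T\<^sub>i\<close>.
\<close>

definition power_class :: "'g::hom_lie_algebra \<Rightarrow> nat \<Rightarrow> nat \<Rightarrow> 'g uea"
  where "power_class x i p =
     uea_class (basis_vec (Some (decorate (weigh p 1 (SOME \<phi>. \<phi> \<in> trees i)) (replicate i x))))"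

text \<open>\<open>exp_hat s x\<close> is the exponential sequence of \<open>sx\<close>.\<close>

definition exp_hat :: "real \<Rightarrow> 'g::hom_lie_algebra \<Rightarrow> nat \<Rightarrow> 'g uea poly"
  where "exp_hat s x = (\<lambda>p. [:uea_unit:] +
     (\<Sum>i=1..p. monom ((s ^ i / fact i) *\<^sub>R power_class x i p) i))"

end

theory Submission
  imports Defs
begin

text \<open>
  The exponential series works for the same reason as in an associative algebra; what has to be
  controlled are the leaf weights and the passage to the quotient.

  Write \<open>P\<^sub>i\<close> for the class of a tree with \<open>i\<close> leaves, all decorated by \<open>x\<close>, in which the weight of
  a leaf plus its distance from the top of the tree is a constant \<open>q\<close> (\<open>hom_power x i q\<close> below).
  Grafting two such trees gives a tree of the same kind with constant \<open>q + 1\<close>, and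
  Hom-associativity makes the class independent of the shape, so the product of \<open>P\<^sub>m\<close> and \<open>P\<^sub>n\<close> at
  level \<open>q\<close> is \<open>P\<^bsub>m+n\<^esub>\<close> at level \<open>q + 1\<close> (\<open>hom_power_vee\<close>).  The twisting map also raises the level
  by one.  The powers thus behave like those of a primitive element of a Hopf algebra:
  \<open>\<Delta> P\<^sub>n = \<Sum>\<^sub>a (n choose a) P\<^sub>a \<otimes> P\<^bsub>n-a\<^esub>\<close>, since leaves are primitive and \<open>\<Delta>\<close> is multiplicative
  (\<open>uea_comult_hom_power\<close>), and \<open>S P\<^sub>n = (-1)\<^sup>n P\<^sub>n\<close>, since \<open>S\<close> reverses products
  (\<open>uea_antipode_hom_power\<close>).  All assertions about the exponential sequence are then comparisons of
  coefficients by means of the binomial theorem.  In particular the convolution of \<open>S\<close> and the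
  identity multiplies \<open>P\<^sub>k\<close> by \<open>(-1 + 1)\<^sup>k\<close>, so the invertibility indexes are all \<open>0\<close>
  (\<open>invertible_at_exp_hat\<close>).

  The structure maps of the enveloping algebra are given by representatives in the space of forests,
  so these computations presuppose that the maps descend.  The enveloping algebra is reached by
  three successive quotients, but the kernel of the composite projection from forests is the smallest
  grafting ideal containing four families of relations: linearity in the decoration of a single leaf,
  Hom-associativity of basis trees, \<open>(|,n) \<otimes> x = (|,0) \<otimes> \<alpha>\<^sup>n(x)\<close>, and the commutator relation
  (\<open>uea_kernel_minimal\<close>).  Comultiplication, counit and antipode are (anti-)multiplicative on
  forests, so their composites with the projection have an ideal as kernel, and it suffices to check
  the four families (\<open>uea_descend\<close>).
\<close>

section \<open>Linear and bilinear extension\<close>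

lemma lookup_scaleR: "Poly_Mapping.lookup (r *\<^sub>R p) b = r *\<^sub>R Poly_Mapping.lookup p b"
proof -
  have "finite {b. r *\<^sub>R Poly_Mapping.lookup p b \<noteq> 0}"
    by (rule finite_subset[OF _ finite_keys[of p]]) (auto simp: in_keys_iff)
  then show ?thesis
    by (simp add: scaleR_poly_mapping_def)
qed

lemma lookup_basis_vec: "Poly_Mapping.lookup (basis_vec b) c = (if b = c then 1 else 0)"
  by (simp add: basis_vec_def lookup_single when_def)

lemma lin_ext_superset:
  assumes "finite A" "Poly_Mapping.keys p \<subseteq> A"
  shows "lin_ext f p = (\<Sum>b\<in>A. Poly_Mapping.lookup p b *\<^sub>R f b)"
  unfolding lin_ext_def using assms
  by (intro sum.mono_neutral_left) (auto simp: in_keys_iff)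

lemma linear_lin_ext: "linear (lin_ext f)"
proof (rule linearI)
  fix p q :: "'a \<Rightarrow>\<^sub>0 real"
  let ?A = "Poly_Mapping.keys p \<union> Poly_Mapping.keys q"
  have "lin_ext f (p + q) = (\<Sum>b\<in>?A. Poly_Mapping.lookup (p + q) b *\<^sub>R f b)"
    by (intro lin_ext_superset finite_UnI finite_keys keys_add)
  moreover have "lin_ext f p = (\<Sum>b\<in>?A. Poly_Mapping.lookup p b *\<^sub>R f b)"
    by (intro lin_ext_superset finite_UnI finite_keys) auto
  moreover have "lin_ext f q = (\<Sum>b\<in>?A. Poly_Mapping.lookup q b *\<^sub>R f b)"
    by (intro lin_ext_superset finite_UnI finite_keys) auto
  ultimately show "lin_ext f (p + q) = lin_ext f p + lin_ext f q"
    by (simp add: lookup_add scaleR_add_left sum.distrib)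
next
  fix r :: real and p :: "'a \<Rightarrow>\<^sub>0 real"
  have "lin_ext f (r *\<^sub>R p) = (\<Sum>b\<in>Poly_Mapping.keys p. Poly_Mapping.lookup (r *\<^sub>R p) b *\<^sub>R f b)"
    by (intro lin_ext_superset finite_keys) (auto simp: in_keys_iff lookup_scaleR)
  then show "lin_ext f (r *\<^sub>R p) = r *\<^sub>R lin_ext f p"
    by (simp add: lookup_scaleR lin_ext_def scaleR_sum_right)
qed

lemma lin_ext_basis_vec [simp]: "lin_ext f (basis_vec b) = f b"
  by (simp add: lin_ext_def basis_vec_def)

lemma lin_ext_basis_vec_id: "lin_ext basis_vec p = p"
proof (rule poly_mapping_eqI)
  fix c
  have "Poly_Mapping.lookup (lin_ext basis_vec p) c
    = (\<Sum>b\<in>Poly_Mapping.keys p. if b = c then Poly_Mapping.lookup p c else 0)"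
    unfolding lin_ext_def lookup_sum
    by (intro sum.cong) (auto simp: lookup_scaleR lookup_basis_vec)
  also have "\<dots> = Poly_Mapping.lookup p c"
    by (simp add: in_keys_iff)
  finally show "Poly_Mapping.lookup (lin_ext basis_vec p) c = Poly_Mapping.lookup p c" .
qed

lemma subspace_basis_UNIV:
  assumes "subspace P" "\<And>b. basis_vec b \<in> P"
  shows "p \<in> P"
proof -
  have "lin_ext basis_vec p \<in> P"
    unfolding lin_ext_def using assms by (intro subspace_sum subspace_scale) auto
  then show ?thesis by (simp add: lin_ext_basis_vec_id)
qed

lemma subspace_linear_eq:
  assumes "linear f" "linear g"
  shows "subspace {p. f p = g p}"
  using assms by (auto simp: subspace_def linear_0 linear_add linear_scale)

lemma linear_eq_on_basis_vec:
  assumes "linear f" "linear g" "\<And>b. f (basis_vec b) = g (basis_vec b)"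
  shows "f p = g p"
  using subspace_basis_UNIV[OF subspace_linear_eq[OF assms(1,2)], of p] assms(3) by simp

lemma linear_compose_fun: "linear f \<Longrightarrow> linear g \<Longrightarrow> linear (\<lambda>x. f (g x))"
  using linear_compose[of g f] by (simp add: o_def)

lemma bilinearI:
  assumes "\<And>x. linear (f x)" "\<And>y. linear (\<lambda>x. f x y)"
  shows "bilinear f"
  using assms by (simp add: bilinear_def)

lemma bilinear_linear_right: "bilinear f \<Longrightarrow> linear g \<Longrightarrow> linear (\<lambda>x. f c (g x))"
  by (auto simp: bilinear_def intro: linear_compose_fun)

lemma bilinear_linear_left: "bilinear f \<Longrightarrow> linear g \<Longrightarrow> linear (\<lambda>x. f (g x) c)"
  unfolding bilinear_def by (rule linear_compose_fun[of "\<lambda>x. f x c" g]) auto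

lemma bilinear_bilin_ext: "bilinear (bilin_ext f)"
proof (rule bilinearI)
  fix p show "linear (bilin_ext f p)"
  proof (rule linearI)
    fix q r show "bilin_ext f p (q + r) = bilin_ext f p q + bilin_ext f p r"
      unfolding bilin_ext_def lin_ext_def[of _ p]
      by (simp add: linear_add[OF linear_lin_ext] scaleR_add_right sum.distrib)
  next
    fix c q show "bilin_ext f p (c *\<^sub>R q) = c *\<^sub>R bilin_ext f p q"
      unfolding bilin_ext_def lin_ext_def[of _ p]
      by (simp add: linear_scale[OF linear_lin_ext] scaleR_sum_right mult.commute)
  qed
next
  fix q show "linear (\<lambda>p. bilin_ext f p q)"
    unfolding bilin_ext_def by (rule linear_lin_ext)
qed

lemma bilin_ext_basis_vec [simp]: "bilin_ext f (basis_vec b) (basis_vec c) = f b c"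
  by (simp add: bilin_ext_def)

lemma linear_id': "linear (\<lambda>x. x)"
  by (rule linearI) auto

lemma bilinear_eq_on_basis_vec:
  assumes "bilinear f" "bilinear g" "\<And>a b. f (basis_vec a) (basis_vec b) = g (basis_vec a) (basis_vec b)"
  shows "f p q = g p q"
proof (rule linear_eq_on_basis_vec[of "\<lambda>p. f p q" "\<lambda>p. g p q"])
  fix a show "f (basis_vec a) q = g (basis_vec a) q"
    by (rule linear_eq_on_basis_vec) (use assms in \<open>auto simp: bilinear_def\<close>)
qed (use assms in \<open>auto simp: bilinear_def\<close>)

lemma bilinear_linear_compose: "bilinear f \<Longrightarrow> linear g \<Longrightarrow> bilinear (\<lambda>a b. g (f a b))"
  unfolding bilinear_def
  by (intro conjI allI; rule linear_compose_fun[of g]; simp)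

lemma bilinear_compose_linear2: "bilinear f \<Longrightarrow> linear g \<Longrightarrow> linear h \<Longrightarrow> bilinear (\<lambda>a b. f (g a) (h b))"
  by (rule bilinearI, rule bilinear_linear_right, assumption+, rule bilinear_linear_left)

lemma subspace_linear_vimage: "linear f \<Longrightarrow> subspace W \<Longrightarrow> subspace {x. f x \<in> W}"
  using linear_subspace_vimage[of f W] by (simp add: vimage_def)

lemma linear_sum_fun:
  assumes "\<And>i. i \<in> A \<Longrightarrow> linear (f i)"
  shows "linear (\<lambda>x. \<Sum>i\<in>A. f i x)"
  using assms by (intro linear_compose_sum) auto

section \<open>Tensor products\<close>

lemma abs_tensor_eq_iff: "abs_tensor p = abs_tensor q \<longleftrightarrow> p - q \<in> span tensor_relations"
  using Quotient3_rel_abs[OF Quotient3_tensor] Quotient3_rel[OF Quotient3_tensor, of p q]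
  by (simp add: eq_modulo_def span_0)

lemma abs_rep_tensor: "abs_tensor (rep_tensor t) = t"
  by (rule Quotient3_abs_rep[OF Quotient3_tensor])

lemma linear_abs_tensor: "linear abs_tensor"
  by (rule linearI) (simp_all add: plus_tensor.abs_eq scaleR_tensor.abs_eq)

lemma abs_tensor_eq_0_iff: "abs_tensor p = 0 \<longleftrightarrow> p \<in> span tensor_relations"
  using abs_tensor_eq_iff[of p 0] by (simp add: linear_0[OF linear_abs_tensor])

lemma tensor_relationsI:
  "basis_vec (a + a', b) - basis_vec (a, b) - basis_vec (a', b) \<in> tensor_relations"
  "basis_vec (a, b + b') - basis_vec (a, b) - basis_vec (a, b') \<in> tensor_relations"
  "basis_vec (r *\<^sub>R a, b) - r *\<^sub>R basis_vec (a, b) \<in> tensor_relations"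
  "basis_vec (a, r *\<^sub>R b) - r *\<^sub>R basis_vec (a, b) \<in> tensor_relations"
  unfolding tensor_relations_def Un_iff mem_Collect_eq
  by ((rule disjI1)+, blast, rule disjI1, rule disjI1, rule disjI2, blast, rule disjI1, rule disjI2, blast, rule disjI2, blast)

lemma bilinear_tensor: "bilinear (\<otimes>)"
proof (rule bilinearI)
  fix a :: 'a
  show "linear ((\<otimes>) a :: 'b \<Rightarrow> ('a, 'b) tensor)"
  proof (rule linearI)
    fix b b' :: 'b
    have "abs_tensor (basis_vec (a, b + b') - basis_vec (a, b) - basis_vec (a, b')) = 0"
      unfolding abs_tensor_eq_0_iff by (rule span_base) (rule tensor_relationsI)
    then show "a \<otimes> (b + b') = a \<otimes> b + a \<otimes> b'"
      by (simp add: tensor_def linear_diff[OF linear_abs_tensor] linear_add[OF linear_abs_tensor] diff_diff_eq)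
  next
    fix r and b :: 'b
    have "abs_tensor (basis_vec (a, r *\<^sub>R b) - r *\<^sub>R basis_vec (a, b)) = 0"
      unfolding abs_tensor_eq_0_iff by (rule span_base) (rule tensor_relationsI)
    then show "a \<otimes> (r *\<^sub>R b) = r *\<^sub>R (a \<otimes> b)"
      by (simp add: tensor_def linear_diff[OF linear_abs_tensor] linear_scale[OF linear_abs_tensor])
  qed
next
  fix b :: 'b
  show "linear (\<lambda>a::'a. a \<otimes> b)"
  proof (rule linearI)
    fix a a' :: 'a
    have "abs_tensor (basis_vec (a + a', b) - basis_vec (a, b) - basis_vec (a', b)) = 0"
      unfolding abs_tensor_eq_0_iff by (rule span_base) (rule tensor_relationsI)
    then show "(a + a') \<otimes> b = a \<otimes> b + a' \<otimes> b"
      by (simp add: tensor_def linear_diff[OF linear_abs_tensor] linear_add[OF linear_abs_tensor] diff_diff_eq)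
  next
    fix r and a :: 'a
    have "abs_tensor (basis_vec (r *\<^sub>R a, b) - r *\<^sub>R basis_vec (a, b)) = 0"
      unfolding abs_tensor_eq_0_iff by (rule span_base) (rule tensor_relationsI)
    then show "(r *\<^sub>R a) \<otimes> b = r *\<^sub>R (a \<otimes> b)"
      by (simp add: tensor_def linear_diff[OF linear_abs_tensor] linear_scale[OF linear_abs_tensor])
  qed
qed

text \<open>
  A bilinear map kills the defining relations of the tensor product, so the value does not depend on
  the representative that enters the definition of \<^const>\<open>tensor_lift\<close>.
\<close>

lemma tensor_lift_abs:
  assumes "bilinear f"
  shows "tensor_lift f (abs_tensor p) = lin_ext (\<lambda>(a, b). f a b) p"
proof -
  let ?F = "lin_ext (\<lambda>(a, b). f a b)"
  have "span tensor_relations \<subseteq> {p. ?F p = 0}"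
    by (rule span_minimal[OF _ linear_subspace_kernel[OF linear_lin_ext]])
      (auto simp: tensor_relations_def linear_diff[OF linear_lin_ext] linear_scale[OF linear_lin_ext]
        bilinear_ladd[OF assms] bilinear_radd[OF assms] bilinear_lmul[OF assms] bilinear_rmul[OF assms])
  moreover have "rep_tensor (abs_tensor p) - p \<in> span tensor_relations"
    using abs_rep_tensor[of "abs_tensor p"] by (simp add: abs_tensor_eq_iff)
  ultimately have "?F (rep_tensor (abs_tensor p) - p) = 0" by auto
  then show ?thesis by (simp add: tensor_lift_def linear_diff[OF linear_lin_ext])
qed

lemma linear_tensor_lift:
  assumes "bilinear f"
  shows "linear (tensor_lift f)"
proof (rule linearI)
  fix s t
  have "tensor_lift f (abs_tensor (rep_tensor s + rep_tensor t)) = tensor_lift f s + tensor_lift f t"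
    unfolding tensor_lift_abs[OF assms] by (simp add: linear_add[OF linear_lin_ext] tensor_lift_def)
  then show "tensor_lift f (s + t) = tensor_lift f s + tensor_lift f t"
    by (simp add: linear_add[OF linear_abs_tensor] abs_rep_tensor)
next
  fix r t
  have "tensor_lift f (abs_tensor (r *\<^sub>R rep_tensor t)) = r *\<^sub>R tensor_lift f t"
    unfolding tensor_lift_abs[OF assms] by (simp add: linear_scale[OF linear_lin_ext] tensor_lift_def)
  then show "tensor_lift f (r *\<^sub>R t) = r *\<^sub>R tensor_lift f t"
    by (simp add: linear_scale[OF linear_abs_tensor] abs_rep_tensor)
qed

lemma tensor_lift_tensor: "bilinear f \<Longrightarrow> tensor_lift f (a \<otimes> b) = f a b"
  by (simp add: tensor_def tensor_lift_abs)

lemma bilinear_tensor_of_linear: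
  assumes "linear f" "linear h"
  shows "bilinear (\<lambda>a b. f a \<otimes> h b)"
  using assms by (intro bilinearI bilinear_linear_left[OF bilinear_tensor] bilinear_linear_right[OF bilinear_tensor])

lemma linear_tensor_map: "linear f \<Longrightarrow> linear h \<Longrightarrow> linear (tensor_map f h)"
  unfolding tensor_map_def by (intro linear_tensor_lift bilinear_tensor_of_linear)

lemma tensor_map_tensor: "linear f \<Longrightarrow> linear h \<Longrightarrow> tensor_map f h (a \<otimes> b) = f a \<otimes> h b"
  unfolding tensor_map_def by (rule tensor_lift_tensor) (rule bilinear_tensor_of_linear)

lemma linear_eq_on_tensor:
  assumes "linear f" "linear g" "\<And>a b. f (a \<otimes> b) = g (a \<otimes> b)"
  shows "f t = g t"
proof -
  have "f (abs_tensor p) = g (abs_tensor p)" for p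
    by (rule linear_eq_on_basis_vec[of "\<lambda>p. f (abs_tensor p)" "\<lambda>p. g (abs_tensor p)"])
       (use assms linear_abs_tensor in \<open>auto simp: tensor_def intro: linear_compose_fun\<close>)
  from this[of "rep_tensor t"] show ?thesis by (simp add: abs_rep_tensor)
qed

section \<open>Grafting of forests\<close>

lemma bilinear_vee: "bilinear vee"
  unfolding vee_def by (rule bilinear_bilin_ext)

lemma linear_alpha: "linear alpha"
  unfolding alpha_def by (rule linear_lin_ext)

lemma vee_basis_vec [simp]: "vee (basis_vec a) (basis_vec b) = basis_vec (graft_basis a b)"
  by (simp add: vee_def)

lemma alpha_basis_vec [simp]: "alpha (basis_vec b) = basis_vec (map_option shift b)"
  by (simp add: alpha_def)

lemma graft_basis_None [simp]:
  "graft_basis None b = map_option shift b" "graft_basis b None = map_option shift b"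
  by (cases b; simp)+

lemma shift_graft_basis:
  "map_option shift (graft_basis a b) = graft_basis (map_option shift a) (map_option shift b)"
  by (cases a; cases b) auto

lemma vee_None: "vee p (basis_vec None) = alpha p" "vee (basis_vec None) p = alpha p"
proof -
  show "vee p (basis_vec None) = alpha p"
    by (rule linear_eq_on_basis_vec[of "\<lambda>p. vee p (basis_vec None)" alpha])
      (use bilinear_vee linear_alpha in \<open>auto simp: bilinear_def\<close>)
  show "vee (basis_vec None) p = alpha p"
    by (rule linear_eq_on_basis_vec[of "\<lambda>p. vee (basis_vec None) p" alpha])
      (use bilinear_vee linear_alpha in \<open>auto simp: bilinear_def\<close>)
qed

lemma alpha_vee: "alpha (vee p q) = vee (alpha p) (alpha q)"
  by (rule bilinear_eq_on_basis_vec[of "\<lambda>p q. alpha (vee p q)" "\<lambda>p q. vee (alpha p) (alpha q)"])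
    (simp_all only: bilinear_linear_compose[OF bilinear_vee linear_alpha]
      bilinear_compose_linear2[OF bilinear_vee linear_alpha linear_alpha] vee_basis_vec alpha_basis_vec shift_graft_basis)

section \<open>Two-sided ideals\<close>

lemma two_sided_ideal_generated: "two_sided_ideal m (ideal_generated m G)"
  unfolding ideal_generated_def by (rule hull_in) (auto simp: two_sided_ideal_def intro!: subspace_Inter)

lemma ideal_generated_base: "g \<in> G \<Longrightarrow> g \<in> ideal_generated m G"
  unfolding ideal_generated_def by (rule hull_inc)

lemma ideal_generated_minimal: "G \<subseteq> I \<Longrightarrow> two_sided_ideal m I \<Longrightarrow> ideal_generated m G \<subseteq> I"
  unfolding ideal_generated_def by (rule hull_minimal)

lemma two_sided_idealD:
  assumes "two_sided_ideal m I"
  shows "subspace I" "w \<in> I \<Longrightarrow> m a w \<in> I" "w \<in> I \<Longrightarrow> m w a \<in> I"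
  using assms by (auto simp: two_sided_ideal_def)

lemma span_two_sided_ideal:
  assumes "bilinear m"
    and "\<And>g a. g \<in> G \<Longrightarrow> m a g \<in> span G" "\<And>g a. g \<in> G \<Longrightarrow> m g a \<in> span G"
  shows "two_sided_ideal m (span G)"
proof -
  have "span G \<subseteq> {w. m a w \<in> span G}" for a
    by (rule span_minimal[OF _ subspace_linear_vimage[OF bilinear_linear_right[OF assms(1) linear_id'] subspace_span]])
      (use assms in auto)
  moreover have "span G \<subseteq> {w. m w a \<in> span G}" for a
    by (rule span_minimal[OF _ subspace_linear_vimage[OF bilinear_linear_left[OF assms(1) linear_id'] subspace_span]])
      (use assms in auto)
  ultimately show ?thesis by (auto simp: two_sided_ideal_def subspace_span)
qed

lemma ideal_vee_span:
  assumes "\<And>g b. g \<in> G \<Longrightarrow> vee (basis_vec b) g \<in> span G" "\<And>g b. g \<in> G \<Longrightarrow> vee g (basis_vec b) \<in> span G"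
  shows "two_sided_ideal vee (span G)"
proof (rule span_two_sided_ideal[OF bilinear_vee])
  fix g a assume g: "g \<in> G"
  have "a \<in> {a. vee a g \<in> span G}"
    by (rule subspace_basis_UNIV[OF subspace_linear_vimage[OF bilinear_linear_left[OF bilinear_vee linear_id'] subspace_span]])
      (use assms g in auto)
  moreover have "a \<in> {a. vee g a \<in> span G}"
    by (rule subspace_basis_UNIV[OF subspace_linear_vimage[OF bilinear_linear_right[OF bilinear_vee linear_id'] subspace_span]])
      (use assms g in auto)
  ultimately show "vee a g \<in> span G" "vee g a \<in> span G" by auto
qed

text \<open>
  The reason why a product defined through representatives of classes modulo \<open>W\<close> is well defined.
\<close>

lemma ideal_congruence:
  assumes "two_sided_ideal m W" "bilinear m" "u - u' \<in> W" "v - v' \<in> W"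
  shows "m u v - m u' v' \<in> W"
proof -
  have "m u v - m u' v' = m (u - u') v + m u' (v - v')"
    by (simp add: bilinear_lsub[OF assms(2)] bilinear_rsub[OF assms(2)])
  then show ?thesis
    using two_sided_idealD[OF assms(1)] assms(3,4) by (simp add: subspace_add)
qed

section \<open>Decorated trees\<close>

lemma num_leaves_shift [simp]: "num_leaves (shift t) = num_leaves t"
  by (induction t) auto

lemma num_leaves_pos: "num_leaves t \<ge> 1"
  by (induction t) auto

lemma shift_decorate: "shift (decorate \<phi> xs) = decorate (shift \<phi>) xs"
  by (induction \<phi> arbitrary: xs) auto

text \<open>
  The relations of the enveloping algebra are written with decorations of undecorated trees, whereas
  the basis of a forest consists of trees that carry their decorations; this translates between
  the two.
\<close>

lemma wtree_is_decorated: "\<exists>\<phi> xs. t = decorate \<phi> xs \<and> length xs = num_leaves \<phi>"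
proof (induction t)
  case (Leaf a x)
  show ?case by (intro exI[of _ "Leaf a ()"] exI[of _ "[x]"]) simp
next
  case (Graft l r)
  then obtain \<phi> xs \<psi> ys where "l = decorate \<phi> xs" "length xs = num_leaves \<phi>"
    "r = decorate \<psi> ys" "length ys = num_leaves \<psi>" by blast
  then show ?case by (intro exI[of _ "Graft \<phi> \<psi>"] exI[of _ "xs @ ys"]) simp
qed

lemma Graft_decorate:
  assumes "length xs = num_leaves \<phi>"
  shows "Graft (decorate \<phi> xs) (decorate \<psi> ys) = decorate (Graft \<phi> \<psi>) (xs @ ys)"
  using assms by simp

primrec leaves_opt :: "'x wtree option \<Rightarrow> nat" where
  "leaves_opt None = 0"
| "leaves_opt (Some t) = num_leaves t"

abbreviation decorate_opt :: "unit wtree option \<Rightarrow> 'x list \<Rightarrow> 'x wtree option"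
  where "decorate_opt b xs \<equiv> map_option (\<lambda>\<phi>. decorate \<phi> xs) b"

lemma leaves_opt_graft_basis [simp]: "leaves_opt (graft_basis a b) = leaves_opt a + leaves_opt b"
  by (cases a; cases b) auto

lemma leaves_opt_shift [simp]: "leaves_opt (map_option shift b) = leaves_opt b"
  by (cases b) auto

lemma decorate_opt_shift: "decorate_opt (map_option shift b) xs = map_option shift (decorate_opt b xs)"
  by (cases b) (auto simp: shift_decorate)

lemma decorate_opt_graft_basis:
  assumes "length xs = leaves_opt a + leaves_opt b"
  shows "decorate_opt (graft_basis a b) xs =
    graft_basis (decorate_opt a (take (leaves_opt a) xs)) (decorate_opt b (drop (leaves_opt a) xs))"
  using assms by (cases a; cases b) (auto simp: shift_decorate)

text \<open>
  The map \<open>p \<mapsto> p\<^sub>n \<otimes> x\<^sub>1 \<otimes> \<dots> \<otimes> x\<^sub>n\<close>, where \<open>p\<^sub>n\<close> is the component of \<open>p\<close> in the span of the trees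
  with \<open>n\<close> leaves.  Discarding the other components makes the map linear on all forests, and makes
  decoration compatible with grafting.
\<close>

definition decorate_forest :: "'x list \<Rightarrow> unit forest \<Rightarrow> 'x forest"
  where "decorate_forest xs =
    lin_ext (\<lambda>b. if leaves_opt b = length xs then basis_vec (decorate_opt b xs) else 0)"

lemma linear_decorate_forest: "linear (decorate_forest xs)"
  unfolding decorate_forest_def by (rule linear_lin_ext)

lemma decorate_forest_basis_vec:
  "decorate_forest xs (basis_vec b) = (if leaves_opt b = length xs then basis_vec (decorate_opt b xs) else 0)"
  by (simp add: decorate_forest_def)

text \<open>
  For basis trees the only surviving summand is the one in which \<open>k\<close> is the number of leaves of the
  left factor.  Summing over all \<open>k\<close> gives a formula that is bilinear in the two factors.
\<close>

lemma decorate_forest_vee: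
  "decorate_forest xs (vee p q) =
    (\<Sum>k\<le>length xs. vee (decorate_forest (take k xs) p) (decorate_forest (drop k xs) q))"
    (is "?L p q = ?R p q")
proof (rule bilinear_eq_on_basis_vec[of ?L ?R])
  show "bilinear ?L"
    by (rule bilinear_linear_compose[OF bilinear_vee linear_decorate_forest])
  show "bilinear ?R"
    by (intro bilinearI linear_sum_fun bilinear_linear_left[OF bilinear_vee]
        bilinear_linear_right[OF bilinear_vee] linear_decorate_forest)
next
  fix a b :: "unit wtree option"
  let ?n = "leaves_opt a"
  have "?R (basis_vec a) (basis_vec b) = (\<Sum>k\<le>length xs. if k = ?n then
       vee (decorate_forest (take ?n xs) (basis_vec a)) (decorate_forest (drop ?n xs) (basis_vec b)) else 0)"
    by (intro sum.cong) (auto simp: decorate_forest_basis_vec bilinear_lzero[OF bilinear_vee])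
  also have "\<dots> = (if ?n \<le> length xs then
       vee (decorate_forest (take ?n xs) (basis_vec a)) (decorate_forest (drop ?n xs) (basis_vec b)) else 0)"
    by simp
  also have "\<dots> = ?L (basis_vec a) (basis_vec b)"
    by (auto simp: decorate_forest_basis_vec decorate_opt_graft_basis
        bilinear_lzero[OF bilinear_vee] bilinear_rzero[OF bilinear_vee])
  finally show "?L (basis_vec a) (basis_vec b) = ?R (basis_vec a) (basis_vec b)" by simp
qed

section \<open>The enveloping algebra as a quotient of forests\<close>

lemma abs_tens_eq_iff: "abs_tens p = abs_tens q \<longleftrightarrow> p - q \<in> span multilinear_relations"
  using Quotient3_rel[OF Quotient3_tens, of p q] by (simp add: eq_modulo_def span_0)

lemma abs_rep_tens: "abs_tens (rep_tens t) = t"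
  by (rule Quotient3_abs_rep[OF Quotient3_tens])

lemma linear_abs_tens: "linear abs_tens"
  by (rule linearI) (simp_all add: plus_tens.abs_eq scaleR_tens.abs_eq)

lemma abs_free_uea_eq_iff: "abs_free_uea p = abs_free_uea q \<longleftrightarrow> p - q \<in> tens_hom_assoc_ideal"
  using Quotient3_rel[OF Quotient3_free_uea, of p q]
  by (simp add: eq_modulo_def subspace_0 subspace_tens_hom_assoc_ideal)

lemma abs_rep_free_uea: "abs_free_uea (rep_free_uea t) = t"
  by (rule Quotient3_abs_rep[OF Quotient3_free_uea])

lemma linear_abs_free_uea: "linear abs_free_uea"
  by (rule linearI) (simp_all add: plus_free_uea.abs_eq scaleR_free_uea.abs_eq)

lemma abs_uea_eq_iff: "abs_uea p = abs_uea q \<longleftrightarrow> p - q \<in> uea_ideal"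
  using Quotient3_rel[OF Quotient3_uea, of p q]
  by (simp add: eq_modulo_def subspace_0 subspace_uea_ideal)

lemma abs_rep_uea: "abs_uea (rep_uea t) = t"
  by (rule Quotient3_abs_rep[OF Quotient3_uea])

lemma linear_abs_uea: "linear abs_uea"
  by (rule linearI) (simp_all add: plus_uea.abs_eq scaleR_uea.abs_eq)

lemma linear_uea_class: "linear uea_class"
  unfolding uea_class_def
  by (intro linear_compose_fun[OF linear_abs_uea] linear_compose_fun[OF linear_abs_free_uea] linear_abs_tens)

lemma uea_class_rep [simp]: "uea_class (uea_rep u) = u"
  by (simp add: uea_class_def uea_rep_def abs_rep_tens abs_rep_free_uea abs_rep_uea)

text \<open>
  Grafting a decorated tree onto a relation only lengthens the list of decorations on one side of
  the distinguished entry, and grafting \<open>\<one>\<close> only shifts the weights, so the result is again one of the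
  relations.
\<close>

lemma multilinear_relations_vee:
  assumes "g \<in> multilinear_relations"
  shows "vee g (basis_vec b) \<in> multilinear_relations \<and> vee (basis_vec b) g \<in> multilinear_relations"
proof (cases b)
  case None
  have "alpha g \<in> multilinear_relations"
    using assms unfolding multilinear_relations_def
    apply (elim UnE CollectE exE conjE)
    subgoal for \<phi> xs x y ys
      by (rule UnI1, rule CollectI, rule exI[of _ "shift \<phi>"], rule exI[of _ xs], rule exI[of _ x],
          rule exI[of _ y], rule exI[of _ ys])
        (simp add: linear_diff[OF linear_alpha] shift_decorate)
    subgoal for \<phi> xs r x ys
      by (rule UnI2, rule CollectI, rule exI[of _ "shift \<phi>"], rule exI[of _ xs], rule exI[of _ r],
          rule exI[of _ x], rule exI[of _ ys])
        (simp add: linear_diff[OF linear_alpha] linear_scale[OF linear_alpha] shift_decorate)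
    done
  then show ?thesis by (simp add: None vee_None)
next
  case (Some t)
  obtain \<psi> zs where t: "t = decorate \<psi> zs" "length zs = num_leaves \<psi>"
    using wtree_is_decorated by blast
  have "vee g (basis_vec b) \<in> multilinear_relations"
    using assms unfolding multilinear_relations_def
    apply (elim UnE CollectE exE conjE)
    subgoal for \<phi> xs x y ys
      by (rule UnI1, rule CollectI, rule exI[of _ "Graft \<phi> \<psi>"], rule exI[of _ xs], rule exI[of _ x],
          rule exI[of _ y], rule exI[of _ "ys @ zs"])
        (simp add: Some t bilinear_lsub[OF bilinear_vee] Graft_decorate del: decorate.simps)
    subgoal for \<phi> xs r x ys
      by (rule UnI2, rule CollectI, rule exI[of _ "Graft \<phi> \<psi>"], rule exI[of _ xs], rule exI[of _ r],
          rule exI[of _ x], rule exI[of _ "ys @ zs"])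
        (simp add: Some t bilinear_lsub[OF bilinear_vee] bilinear_lmul[OF bilinear_vee]
          Graft_decorate del: decorate.simps)
    done
  moreover have "vee (basis_vec b) g \<in> multilinear_relations"
    using assms unfolding multilinear_relations_def
    apply (elim UnE CollectE exE conjE)
    subgoal for \<phi> xs x y ys
      by (rule UnI1, rule CollectI, rule exI[of _ "Graft \<psi> \<phi>"], rule exI[of _ "zs @ xs"], rule exI[of _ x],
          rule exI[of _ y], rule exI[of _ ys])
        (simp add: Some t bilinear_rsub[OF bilinear_vee] Graft_decorate del: decorate.simps)
    subgoal for \<phi> xs r x ys
      by (rule UnI2, rule CollectI, rule exI[of _ "Graft \<psi> \<phi>"], rule exI[of _ "zs @ xs"], rule exI[of _ r],
          rule exI[of _ x], rule exI[of _ ys])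
        (simp add: Some t bilinear_rsub[OF bilinear_vee] bilinear_rmul[OF bilinear_vee]
          Graft_decorate del: decorate.simps)
    done
  ultimately show ?thesis by simp
qed

lemma ideal_multilinear: "two_sided_ideal vee (span multilinear_relations)"
  by (rule ideal_vee_span) (auto dest: multilinear_relations_vee intro: span_base)

lemma vee_tens_abs: "vee_tens (abs_tens p) (abs_tens q) = abs_tens (vee p q)"
  unfolding vee_tens_def abs_tens_eq_iff
  by (rule ideal_congruence[OF ideal_multilinear bilinear_vee])
    (simp_all add: abs_tens_eq_iff[symmetric] abs_rep_tens)

lemma bilinear_vee_tens: "bilinear vee_tens"
proof (rule bilinearI)
  fix u :: "'a tens"
  show "linear (vee_tens u)"
  proof (rule linearI)
    fix v w :: "'a tens" and r
    have "abs_tens (vee (rep_tens u) (rep_tens v + rep_tens w)) = vee_tens u v + vee_tens u w"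
      by (simp add: bilinear_radd[OF bilinear_vee] linear_add[OF linear_abs_tens] vee_tens_def)
    then show "vee_tens u (v + w) = vee_tens u v + vee_tens u w"
      by (simp add: vee_tens_abs[symmetric] linear_add[OF linear_abs_tens] abs_rep_tens)
    have "abs_tens (vee (rep_tens u) (r *\<^sub>R rep_tens v)) = r *\<^sub>R vee_tens u v"
      by (simp add: bilinear_rmul[OF bilinear_vee] linear_scale[OF linear_abs_tens] vee_tens_def)
    then show "vee_tens u (r *\<^sub>R v) = r *\<^sub>R vee_tens u v"
      by (simp add: vee_tens_abs[symmetric] linear_scale[OF linear_abs_tens] abs_rep_tens)
  qed
next
  fix u :: "'a tens"
  show "linear (\<lambda>v. vee_tens v u)"
  proof (rule linearI)
    fix v w :: "'a tens" and r
    have "abs_tens (vee (rep_tens v + rep_tens w) (rep_tens u)) = vee_tens v u + vee_tens w u"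
      by (simp add: bilinear_ladd[OF bilinear_vee] linear_add[OF linear_abs_tens] vee_tens_def)
    then show "vee_tens (v + w) u = vee_tens v u + vee_tens w u"
      by (simp add: vee_tens_abs[symmetric] linear_add[OF linear_abs_tens] abs_rep_tens)
    have "abs_tens (vee (r *\<^sub>R rep_tens v) (rep_tens u)) = r *\<^sub>R vee_tens v u"
      by (simp add: bilinear_lmul[OF bilinear_vee] linear_scale[OF linear_abs_tens] vee_tens_def)
    then show "vee_tens (r *\<^sub>R v) u = r *\<^sub>R vee_tens v u"
      by (simp add: vee_tens_abs[symmetric] linear_scale[OF linear_abs_tens] abs_rep_tens)
  qed
qed

lemma pure_tens_decorate_forest:
  assumes "p \<in> B_span (length xs)"
  shows "pure_tens p xs = abs_tens (decorate_forest xs p)"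
proof -
  have "B_span (length xs) \<subseteq> {p. lin_ext (\<lambda>b. basis_vec (decorate_opt b xs)) p = decorate_forest xs p}"
    unfolding B_span_def
    by (rule span_minimal) (auto simp: decorate_forest_basis_vec
      intro!: subspace_linear_eq linear_lin_ext linear_decorate_forest)
  then show ?thesis using assms by (auto simp: pure_tens_def)
qed

lemma B_span_vee:
  assumes "p \<in> B_span n"
  shows "vee p (basis_vec b) \<in> B_span (n + leaves_opt b)" "vee (basis_vec b) p \<in> B_span (leaves_opt b + n)"
proof -
  have base: "basis_vec c \<in> B_span n" if "leaves_opt c = n" "c \<noteq> None" for c n
    using that unfolding B_span_def by (cases c) (auto intro!: span_base)
  have sub: "subspace (B_span k)" for k
    unfolding B_span_def by (rule subspace_span)
  have "B_span n \<subseteq> {p. vee p (basis_vec b) \<in> B_span (n + leaves_opt b)}"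
    unfolding B_span_def[of n]
    by (rule span_minimal[OF _ subspace_linear_vimage[OF bilinear_linear_left[OF bilinear_vee linear_id'] sub]])
      (cases b; auto intro!: base)
  then show "vee p (basis_vec b) \<in> B_span (n + leaves_opt b)" using assms by auto
  have "B_span n \<subseteq> {p. vee (basis_vec b) p \<in> B_span (leaves_opt b + n)}"
    unfolding B_span_def[of n]
    by (rule span_minimal[OF _ subspace_linear_vimage[OF bilinear_linear_right[OF bilinear_vee linear_id'] sub]])
      (cases b; auto intro!: base)
  then show "vee (basis_vec b) p \<in> B_span (leaves_opt b + n)" using assms by auto
qed

section \<open>The kernel of the projection from forests\<close>

abbreviation hom_associator :: "'x wtree option \<Rightarrow> 'x wtree option \<Rightarrow> 'x wtree option \<Rightarrow> 'x forest"
  where "hom_associator a b c \<equiv>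
    vee (vee (basis_vec a) (basis_vec b)) (alpha (basis_vec c))
      - vee (alpha (basis_vec a)) (vee (basis_vec b) (basis_vec c))"

text \<open>
  All trees of a Hom-associator have the same number of leaves, and the three subtrees occur in the
  same order; a list of decorations is therefore distributed in the same way over both terms.
\<close>

lemma decorate_hom_associator:
  "decorate_forest xs (hom_associator a b c) = 0
    \<or> (\<exists>a' b' c'. decorate_forest xs (hom_associator a b c) = hom_associator a' b' c')"
proof (cases "length xs = leaves_opt a + leaves_opt b + leaves_opt c")
  case True
  define ys where "ys = take (leaves_opt b) (drop (leaves_opt a) xs)"
  have 1: "take (leaves_opt a) (take (leaves_opt a + leaves_opt b) xs) = take (leaves_opt a) xs"
    "drop (leaves_opt a) (take (leaves_opt a + leaves_opt b) xs) = ys"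
    "drop (leaves_opt b) (drop (leaves_opt a) xs) = drop (leaves_opt a + leaves_opt b) xs"
    by (auto simp: ys_def drop_take add.commute)
  show ?thesis
    using True 1
    by (intro disjI2 exI[of _ "decorate_opt a (take (leaves_opt a) xs)"]
       exI[of _ "decorate_opt b ys"] exI[of _ "decorate_opt c (drop (leaves_opt a + leaves_opt b) xs)"])
     (simp add: linear_diff[OF linear_decorate_forest] decorate_forest_basis_vec
        decorate_opt_graft_basis decorate_opt_shift ys_def[symmetric])
next
  case False
  then show ?thesis
    by (simp add: linear_diff[OF linear_decorate_forest] decorate_forest_basis_vec)
qed

text \<open>
  Ideals of decorated forests can be pulled back to undecorated ones, which makes it possible to
  compare them with an ideal given by undecorated generators.
\<close>

lemma two_sided_ideal_decorated:
  assumes P: "two_sided_ideal vee P"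
  shows "two_sided_ideal vee {p. \<forall>xs. decorate_forest xs p \<in> P}"
  unfolding two_sided_ideal_def
proof (intro conjI allI ballI)
  show "subspace {p. \<forall>xs. decorate_forest xs p \<in> P}"
    using two_sided_idealD(1)[OF P]
    by (auto simp: subspace_def linear_0[OF linear_decorate_forest] linear_add[OF linear_decorate_forest]
        linear_scale[OF linear_decorate_forest])
next
  fix a w assume "w \<in> {p. \<forall>xs. decorate_forest xs p \<in> P}"
  then show "vee a w \<in> {p. \<forall>xs. decorate_forest xs p \<in> P}"
      "vee w a \<in> {p. \<forall>xs. decorate_forest xs p \<in> P}"
    using two_sided_idealD[OF P] by (auto simp: decorate_forest_vee intro!: subspace_sum)
qed

text \<open>
  The ideal \<open>\<I>\<^sup>\<gg>\<close> is defined by decorating all elements of \<open>\<I>\<close>, not by generators.  Pulling \<open>P\<close> back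
  to undecorated forests shows that it is enough to look at the decorated generators.
\<close>

lemma decorate_hom_assoc_ideal:
  assumes P: "two_sided_ideal vee P" and assoc: "\<And>a b c. hom_associator a b c \<in> P"
    and p: "p \<in> hom_assoc_ideal"
  shows "decorate_forest xs p \<in> P"
proof -
  have "hom_assoc_ideal \<subseteq> {p. \<forall>xs. decorate_forest xs p \<in> P}"
    unfolding hom_assoc_ideal_def
  proof (rule ideal_generated_minimal[OF _ two_sided_ideal_decorated[OF P]], safe)
    fix a b c xs
    show "decorate_forest xs (hom_associator a b c) \<in> P"
      using decorate_hom_associator[of xs a b c] assoc two_sided_idealD(1)[OF P, THEN subspace_0] by metis
  qed
  then show ?thesis using p by auto
qed

text \<open>
  The product of \<open>p \<otimes> x\<^sub>1 \<otimes> \<dots> \<otimes> x\<^sub>n\<close> with a decorated tree \<open>\<psi>\<close> is \<open>p \<or> \<psi>\<close> decorated with the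
  concatenated list.  It has the required form again, because \<open>\<I>\<close> is an ideal and grafting does not
  decrease the number of leaves.
\<close>

lemma ideal_tens_hom_assoc: "two_sided_ideal vee_tens tens_hom_assoc_ideal"
  unfolding tens_hom_assoc_ideal_def
proof (rule span_two_sided_ideal[OF bilinear_vee_tens])
  let ?G = "{pure_tens p xs |p xs. 3 \<le> length xs \<and> p \<in> hom_assoc_ideal \<inter> B_span (length xs)}"
  fix g u :: "'a tens" assume "g \<in> ?G"
  then obtain p xs where g: "g = pure_tens p xs" "length xs \<ge> 3" "p \<in> hom_assoc_ideal"
    "p \<in> B_span (length xs)" by auto
  have hom: "vee p b \<in> hom_assoc_ideal" "vee b p \<in> hom_assoc_ideal" for b
    using g(3) two_sided_idealD[OF two_sided_ideal_generated] unfolding hom_assoc_ideal_def by blast+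
  have basis: "vee_tens (abs_tens (basis_vec b)) g \<in> ?G \<and> vee_tens g (abs_tens (basis_vec b)) \<in> ?G" for b
  proof -
    have "\<exists>c zs. b = decorate_opt c zs \<and> length zs = leaves_opt c"
    proof (cases b)
      case None
      then show ?thesis by (intro exI[of _ None] exI[of _ "[]"]) simp
    next
      case (Some t)
      obtain \<phi> zs where "t = decorate \<phi> zs" "length zs = num_leaves \<phi>"
        using wtree_is_decorated by blast
      with Some show ?thesis by (intro exI[of _ "Some \<phi>"] exI[of _ zs]) simp
    qed
    then obtain c zs where b: "b = decorate_opt c zs" "length zs = leaves_opt c" by blast
    have dz: "decorate_forest zs (basis_vec c) = basis_vec b"
      using b by (simp add: decorate_forest_basis_vec)
    have 0: "decorate_forest ys p = 0" if "length ys \<noteq> length xs" for ys :: "'a list"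
    proof -
      have "B_span (length xs) \<subseteq> {p. decorate_forest ys p = 0}"
        unfolding B_span_def
        by (rule span_minimal[OF _ linear_subspace_kernel[OF linear_decorate_forest]])
          (use that in \<open>auto simp: decorate_forest_basis_vec\<close>)
      then show ?thesis using g by auto
    qed
    (* Among the ways of cutting the concatenated list, only the one at the end of the given list
       meets trees of the right size. *)
    have "decorate_forest (xs @ zs) (vee p (basis_vec c)) =
        (\<Sum>k\<le>length (xs @ zs). if k = length xs then vee (decorate_forest xs p) (basis_vec b) else 0)"
      unfolding decorate_forest_vee
      by (intro sum.cong refl) (use dz in \<open>auto simp: 0 bilinear_lzero[OF bilinear_vee]\<close>)
    then have "decorate_forest (xs @ zs) (vee p (basis_vec c)) = vee (decorate_forest xs p) (basis_vec b)"
      by simp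
    then have "vee_tens g (abs_tens (basis_vec b)) = pure_tens (vee p (basis_vec c)) (xs @ zs)"
      using B_span_vee(1)[OF g(4), of c] b(2)
      by (simp add: g(1) pure_tens_decorate_forest g(4) vee_tens_abs)
    then have r: "vee_tens g (abs_tens (basis_vec b)) \<in> ?G"
      using B_span_vee(1)[OF g(4), of c] b(2) g(2) hom(1)[of "basis_vec c"]
      by (auto intro!: exI[of _ "vee p (basis_vec c)"] exI[of _ "xs @ zs"])
    have "decorate_forest (zs @ xs) (vee (basis_vec c) p) =
        (\<Sum>k\<le>length (zs @ xs). if k = length zs then vee (basis_vec b) (decorate_forest xs p) else 0)"
      unfolding decorate_forest_vee
      by (intro sum.cong refl) (use dz in \<open>auto simp: 0 bilinear_rzero[OF bilinear_vee]\<close>)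
    then have "decorate_forest (zs @ xs) (vee (basis_vec c) p) = vee (basis_vec b) (decorate_forest xs p)"
      by simp
    then have "vee_tens (abs_tens (basis_vec b)) g = pure_tens (vee (basis_vec c) p) (zs @ xs)"
      using B_span_vee(2)[OF g(4), of c] b(2)
      by (simp add: g(1) pure_tens_decorate_forest g(4) vee_tens_abs)
    then have "vee_tens (abs_tens (basis_vec b)) g \<in> ?G"
      using B_span_vee(2)[OF g(4), of c] b(2) g(2) hom(2)[of "basis_vec c"]
      by (auto intro!: exI[of _ "vee (basis_vec c) p"] exI[of _ "zs @ xs"])
    with r show ?thesis by simp
  qed
  have "rep_tens u \<in> {q. vee_tens (abs_tens q) g \<in> span ?G}"
    by (rule subspace_basis_UNIV[OF subspace_linear_vimage[OF
          bilinear_linear_left[OF bilinear_vee_tens linear_abs_tens] subspace_span]])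
      (use basis in \<open>auto intro: span_base\<close>)
  then show "vee_tens u g \<in> span ?G" by (simp add: abs_rep_tens)
  have "rep_tens u \<in> {q. vee_tens g (abs_tens q) \<in> span ?G}"
    by (rule subspace_basis_UNIV[OF subspace_linear_vimage[OF
          bilinear_linear_right[OF bilinear_vee_tens linear_abs_tens] subspace_span]])
      (use basis in \<open>auto intro: span_base\<close>)
  then show "vee_tens g u \<in> span ?G" by (simp add: abs_rep_tens)
qed

lemma vee_free_uea_abs:
  "vee_free_uea (abs_free_uea (abs_tens p)) (abs_free_uea (abs_tens q)) = abs_free_uea (abs_tens (vee p q))"
  unfolding vee_free_uea_def vee_tens_abs[symmetric] abs_free_uea_eq_iff
  by (rule ideal_congruence[OF ideal_tens_hom_assoc bilinear_vee_tens])
    (simp_all add: abs_free_uea_eq_iff[symmetric] abs_rep_free_uea)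

lemma uea_class_eq_0_iff: "uea_class p = 0 \<longleftrightarrow> abs_free_uea (abs_tens p) \<in> uea_ideal"
proof -
  have "uea_class p = 0 \<longleftrightarrow> abs_uea (abs_free_uea (abs_tens p)) = abs_uea 0"
    by (simp add: uea_class_def linear_0[OF linear_abs_uea])
  then show ?thesis by (simp add: abs_uea_eq_iff)
qed

lemma ideal_uea_kernel: "two_sided_ideal vee {p. uea_class p = 0}"
  unfolding two_sided_ideal_def
proof (intro conjI allI ballI)
  show "subspace {p. uea_class p = 0}" by (rule linear_subspace_kernel[OF linear_uea_class])
next
  fix a w :: "'a forest" assume "w \<in> {p. uea_class p = 0}"
  then have "abs_free_uea (abs_tens w) \<in> uea_ideal" by (simp add: uea_class_eq_0_iff)
  then show "vee a w \<in> {p. uea_class p = 0}" "vee w a \<in> {p. uea_class p = 0}"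
    unfolding mem_Collect_eq uea_class_eq_0_iff vee_free_uea_abs[symmetric] uea_ideal_def
    by (blast intro: two_sided_idealD[OF two_sided_ideal_generated])+
qed

lemma uea_vee_class: "uea_vee (uea_class p) (uea_class q) = uea_class (vee p q)"
  using ideal_congruence[OF ideal_uea_kernel bilinear_vee, of "uea_rep (uea_class p)" p "uea_rep (uea_class q)" q]
  by (simp add: uea_vee_def linear_diff[OF linear_uea_class])

text \<open>
  For three trees this is a decorated element of \<open>\<I>\<close> with at least three leaves, as the definition of
  \<open>\<I>\<^sup>\<gg>\<close> demands.  If one of the entries is \<open>\<one>\<close>, the Hom-associator is already zero as a forest, since
  grafting \<open>\<one>\<close> is \<open>\<alpha>\<close> and \<open>\<alpha>\<close> is multiplicative.
\<close>

lemma uea_class_hom_associator: "uea_class (hom_associator a b c) = 0"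
proof (cases "a = None \<or> b = None \<or> c = None")
  case True
  then have "hom_associator a b c = 0"
    by (cases a; cases b; cases c) auto
  then show ?thesis by (simp only: linear_0[OF linear_uea_class])
next
  case False
  then obtain r s t where rst: "a = Some r" "b = Some s" "c = Some t" by auto
  obtain \<phi> xs where r: "r = decorate \<phi> xs" "length xs = num_leaves \<phi>"
    using wtree_is_decorated by blast
  obtain \<psi> ys where s: "s = decorate \<psi> ys" "length ys = num_leaves \<psi>"
    using wtree_is_decorated by blast
  obtain \<rho> zs where t: "t = decorate \<rho> zs" "length zs = num_leaves \<rho>"
    using wtree_is_decorated by blast
  let ?q = "hom_associator (Some \<phi>) (Some \<psi>) (Some \<rho>)"
  let ?xs = "xs @ ys @ zs"
  have "?q \<in> hom_assoc_ideal"
    unfolding hom_assoc_ideal_def by (rule ideal_generated_base) blast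
  moreover have q: "?q \<in> B_span (length ?xs)"
    unfolding B_span_def by (simp add: r s t, intro subspace_diff subspace_span span_base) auto
  moreover have "length ?xs \<ge> 3"
    using num_leaves_pos[of \<phi>] num_leaves_pos[of \<psi>] num_leaves_pos[of \<rho>] r s t by simp
  ultimately have "pure_tens ?q ?xs \<in> tens_hom_assoc_ideal"
    unfolding tens_hom_assoc_ideal_def by (intro span_base) blast
  moreover have "pure_tens ?q ?xs = abs_tens (hom_associator a b c)"
    unfolding pure_tens_decorate_forest[OF q]
    by (simp add: rst r s t linear_diff[OF linear_decorate_forest] decorate_forest_basis_vec shift_decorate)
  ultimately have "abs_free_uea (abs_tens (hom_associator a b c)) = abs_free_uea 0"
    by (simp only: abs_free_uea_eq_iff diff_zero)
  then have "abs_free_uea (abs_tens (hom_associator a b c)) = 0"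
    by (simp only: linear_0[OF linear_abs_free_uea])
  then show ?thesis
    by (simp only: uea_class_def linear_0[OF linear_abs_uea])
qed

abbreviation uea_leaf :: "nat \<Rightarrow> 'x \<Rightarrow> 'x forest"
  where "uea_leaf n x \<equiv> basis_vec (Some (Leaf n x))"

lemma pure_free_uea_eq:
  "length xs = num_leaves \<phi> \<Longrightarrow> pure_free_uea \<phi> xs = abs_free_uea (abs_tens (basis_vec (Some (decorate \<phi> xs))))"
  by (simp add: pure_free_uea_def pure_tens_def)

text \<open>
  A relation in one leaf of a tree arises from the relation for that leaf alone by grafting the rest
  of the tree around it.
\<close>

lemma multilinear_relations_subset:
  assumes P: "two_sided_ideal vee P"
    and add: "\<And>a x y. uea_leaf a (x + y) - uea_leaf a x - uea_leaf a y \<in> P"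
    and scale: "\<And>a r x. uea_leaf a (r *\<^sub>R x) - r *\<^sub>R uea_leaf a x \<in> P"
  shows "multilinear_relations \<subseteq> P"
proof -
  note ideal = two_sided_idealD[OF P]
  let ?d = "\<lambda>\<phi> xs. basis_vec (Some (decorate \<phi> xs))"
  have graft: "?d (Graft l r) xs = vee (?d l (take (num_leaves l) xs)) (?d r (drop (num_leaves l) xs))"
    for l r and xs :: "'a list"
    by simp
  have A: "?d \<phi> (xs @ (x + y) # ys) - ?d \<phi> (xs @ x # ys) - ?d \<phi> (xs @ y # ys) \<in> P"
    if "length xs + 1 + length ys = num_leaves \<phi>" for \<phi> xs x y ys
    using that
  proof (induction \<phi> arbitrary: xs ys)
    case (Leaf a u)
    then show ?case using add by simp
  next
    case (Graft l r)
    let ?n = "num_leaves l"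
    show ?case
    proof (cases "length xs < ?n")
      case True
      then have eq: "take ?n (xs @ z # ys) = xs @ z # take (?n - length xs - 1) ys"
        "drop ?n (xs @ z # ys) = drop (?n - length xs - 1) ys" for z
        by (auto simp: take_Cons' drop_Cons')
      show ?thesis
        unfolding graft eq bilinear_lsub[OF bilinear_vee, symmetric]
        by (rule ideal(3), rule Graft.IH(1)) (use True Graft.prems in auto)
    next
      case False
      then have eq: "take ?n (xs @ z # ys) = take ?n xs"
        "drop ?n (xs @ z # ys) = drop ?n xs @ z # ys" for z
        by auto
      show ?thesis
        unfolding graft eq bilinear_rsub[OF bilinear_vee, symmetric]
        by (rule ideal(2), rule Graft.IH(2)) (use False Graft.prems in auto)
    qed
  qed
  have B: "?d \<phi> (xs @ (c *\<^sub>R x) # ys) - c *\<^sub>R ?d \<phi> (xs @ x # ys) \<in> P"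
    if "length xs + 1 + length ys = num_leaves \<phi>" for \<phi> xs c x ys
    using that
  proof (induction \<phi> arbitrary: xs ys)
    case (Leaf a u)
    then show ?case using scale by simp
  next
    case (Graft l r)
    let ?n = "num_leaves l"
    show ?case
    proof (cases "length xs < ?n")
      case True
      then have eq: "take ?n (xs @ z # ys) = xs @ z # take (?n - length xs - 1) ys"
        "drop ?n (xs @ z # ys) = drop (?n - length xs - 1) ys" for z
        by (auto simp: take_Cons' drop_Cons')
      show ?thesis
        unfolding graft eq bilinear_lmul[OF bilinear_vee, symmetric] bilinear_lsub[OF bilinear_vee, symmetric]
        by (rule ideal(3), rule Graft.IH(1)) (use True Graft.prems in auto)
    next
      case False
      then have eq: "take ?n (xs @ z # ys) = take ?n xs"
        "drop ?n (xs @ z # ys) = drop ?n xs @ z # ys" for z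
        by auto
      show ?thesis
        unfolding graft eq bilinear_rmul[OF bilinear_vee, symmetric] bilinear_rsub[OF bilinear_vee, symmetric]
        by (rule ideal(2), rule Graft.IH(2)) (use False Graft.prems in auto)
    qed
  qed
  show ?thesis
    unfolding multilinear_relations_def using A B by blast
qed

text \<open>
  The induction principle for relations in the enveloping algebra: the three successive quotients
  amount to dividing out one ideal of forests, generated by relations between small trees and
  Hom-associators.  The image of \<open>P\<close> at each stage contains what is divided out at that stage.
\<close>

lemma uea_kernel_minimal:
  fixes P :: "'g::hom_lie_algebra forest set"
  assumes P: "two_sided_ideal vee P"
    and add: "\<And>a x y. uea_leaf a (x + y) - uea_leaf a x - uea_leaf a y \<in> P"
    and scale: "\<And>a r x. uea_leaf a (r *\<^sub>R x) - r *\<^sub>R uea_leaf a x \<in> P"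
    and assoc: "\<And>a b c. hom_associator a b c \<in> P"
    and twist: "\<And>n x. uea_leaf n x - uea_leaf 0 ((htwist ^^ n) x) \<in> P"
    and bracket: "\<And>x y. vee (uea_leaf 0 x) (uea_leaf 0 y) - vee (uea_leaf 0 y) (uea_leaf 0 x)
        - uea_leaf 0 (hbracket x y) \<in> P"
    and p: "uea_class p = 0"
  shows "p \<in> P"
proof -
  note sub = two_sided_idealD(1)[OF P]
  let ?\<pi> = "\<lambda>p. abs_free_uea (abs_tens p)"
  have lin: "linear ?\<pi>" by (rule linear_compose_fun[OF linear_abs_free_uea linear_abs_tens])
  have multilinear: "span multilinear_relations \<subseteq> P"
    by (rule span_minimal[OF multilinear_relations_subset[OF P add scale] sub])
  have tens: "tens_hom_assoc_ideal \<subseteq> abs_tens ` P"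
    unfolding tens_hom_assoc_ideal_def
  proof (rule span_minimal[OF _ linear_subspace_image[OF linear_abs_tens sub]], safe)
    fix p and xs :: "'g list" assume "p \<in> hom_assoc_ideal" "p \<in> B_span (length xs)"
    then show "pure_tens p xs \<in> abs_tens ` P"
      by (simp add: pure_tens_decorate_forest decorate_hom_assoc_ideal[OF P assoc])
  qed
  have "uea_ideal \<subseteq> ?\<pi> ` P"
    unfolding uea_ideal_def
  proof (rule ideal_generated_minimal)
    have "?\<pi> (uea_leaf n x - uea_leaf 0 ((htwist ^^ n) x)) \<in> ?\<pi> ` P"
      "?\<pi> (vee (uea_leaf 0 x) (uea_leaf 0 y) - vee (uea_leaf 0 y) (uea_leaf 0 x)
        - uea_leaf 0 (hbracket x y)) \<in> ?\<pi> ` P" for n and x y :: 'g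
      by (intro imageI twist bracket)+
    then show "{pure_free_uea (Leaf n ()) [x] - pure_free_uea (Leaf 0 ()) [(htwist ^^ n) x] | n x. True}
    \<union> {pure_free_uea (Graft (Leaf 0 ()) (Leaf 0 ())) [x, y]
         - pure_free_uea (Graft (Leaf 0 ()) (Leaf 0 ())) [y, x]
         - pure_free_uea (Leaf 0 ()) [hbracket x y] | x y. True} \<subseteq> ?\<pi> ` P"
      by (auto simp: pure_free_uea_eq linear_diff[OF lin])
  next
    have surj: "\<exists>q. u = ?\<pi> q" for u :: "'g free_uea"
      by (metis abs_rep_free_uea abs_rep_tens)
    show "two_sided_ideal vee_free_uea (?\<pi> ` P)"
      unfolding two_sided_ideal_def
    proof (intro conjI allI ballI)
      show "subspace (?\<pi> ` P)" by (rule linear_subspace_image[OF lin sub])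
    next
      fix u w :: "'g free_uea" assume "w \<in> ?\<pi> ` P"
      then obtain q where q: "w = ?\<pi> q" "q \<in> P" by auto
      obtain r where r: "u = ?\<pi> r" using surj[of u] by (elim exE)
      show "vee_free_uea u w \<in> ?\<pi> ` P" "vee_free_uea w u \<in> ?\<pi> ` P"
        unfolding q r vee_free_uea_abs by (intro imageI two_sided_idealD[OF P] q)+
    qed
  qed
  then obtain q where q: "q \<in> P" "?\<pi> p = ?\<pi> q" using p by (auto simp: uea_class_eq_0_iff)
  (* Each quotient map is undone up to an element of P: first q, then r, and finally a combination
     of the multilinear relations. *)
  then have "abs_tens (p - q) \<in> tens_hom_assoc_ideal"
    by (simp add: abs_free_uea_eq_iff linear_diff[OF linear_abs_tens])
  then obtain r where r: "r \<in> P" "abs_tens (p - q) = abs_tens r" using tens by auto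
  then have "p - q - r \<in> P" using multilinear by (auto simp: abs_tens_eq_iff)
  then have "(p - q - r) + (q + r) \<in> P" using q(1) r(1) by (intro subspace_add[OF sub])
  then show ?thesis by (simp add: algebra_simps)
qed

lemma uea_class_leaf_linear: "linear (\<lambda>x. uea_class (uea_leaf n x))"
proof (rule linearI)
  have class0: "uea_class p = 0" if "p \<in> multilinear_relations" for p :: "'a forest"
  proof -
    have "abs_tens p = abs_tens 0" using that by (simp add: abs_tens_eq_iff span_base)
    then show ?thesis by (simp add: uea_class_def linear_0[OF linear_abs_uea]
      linear_0[OF linear_abs_free_uea] linear_0[OF linear_abs_tens])
  qed
  fix x y :: 'a and r
  have "basis_vec (Some (decorate (Leaf n ()) ([] @ (x + y) # [])))
        - basis_vec (Some (decorate (Leaf n ()) ([] @ x # [])))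
        - basis_vec (Some (decorate (Leaf n ()) ([] @ y # []))) \<in> multilinear_relations"
    unfolding multilinear_relations_def by (rule UnI1, rule CollectI, intro exI conjI, rule refl) simp
  from class0[OF this] show "uea_class (uea_leaf n (x + y)) = uea_class (uea_leaf n x) + uea_class (uea_leaf n y)"
    by (simp add: linear_diff[OF linear_uea_class] linear_add[OF linear_uea_class] diff_diff_eq)
  have "basis_vec (Some (decorate (Leaf n ()) ([] @ (r *\<^sub>R x) # [])))
        - r *\<^sub>R basis_vec (Some (decorate (Leaf n ()) ([] @ x # []))) \<in> multilinear_relations"
    unfolding multilinear_relations_def by (rule UnI2, rule CollectI, intro exI conjI, rule refl) simp
  from class0[OF this] show "uea_class (uea_leaf n (r *\<^sub>R x)) = r *\<^sub>R uea_class (uea_leaf n x)"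
    by (simp add: linear_diff[OF linear_uea_class] linear_scale[OF linear_uea_class])
qed

lemma uea_class_twist: "uea_class (uea_leaf n x) = uea_class (uea_leaf 0 ((htwist ^^ n) x))"
proof -
  have "pure_free_uea (Leaf n ()) [x] - pure_free_uea (Leaf 0 ()) [(htwist ^^ n) x] \<in> uea_ideal"
    unfolding uea_ideal_def by (rule ideal_generated_base) blast
  then have "uea_class (uea_leaf n x - uea_leaf 0 ((htwist ^^ n) x)) = 0"
    by (simp add: uea_class_eq_0_iff pure_free_uea_eq linear_diff[OF linear_abs_tens] linear_diff[OF linear_abs_free_uea])
  then show ?thesis by (simp add: linear_diff[OF linear_uea_class])
qed

lemma uea_class_bracket: "uea_class (vee (uea_leaf 0 x) (uea_leaf 0 y)) - uea_class (vee (uea_leaf 0 y) (uea_leaf 0 x))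
  = uea_class (uea_leaf 0 (hbracket x y))"
proof -
  have "pure_free_uea (Graft (Leaf 0 ()) (Leaf 0 ())) [x, y]
         - pure_free_uea (Graft (Leaf 0 ()) (Leaf 0 ())) [y, x]
         - pure_free_uea (Leaf 0 ()) [hbracket x y] \<in> uea_ideal"
    unfolding uea_ideal_def by (rule ideal_generated_base) blast
  then have "uea_class (vee (uea_leaf 0 x) (uea_leaf 0 y) - vee (uea_leaf 0 y) (uea_leaf 0 x) - uea_leaf 0 (hbracket x y)) = 0"
    by (simp add: uea_class_eq_0_iff pure_free_uea_eq linear_diff[OF linear_abs_tens] linear_diff[OF linear_abs_free_uea])
  then show ?thesis by (simp add: linear_diff[OF linear_uea_class])
qed

section \<open>The multiplication of the enveloping algebra\<close>

abbreviation uea_basis :: "'g::hom_lie_algebra wtree option \<Rightarrow> 'g uea"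
  where "uea_basis b \<equiv> uea_class (basis_vec b)"

lemma uea_basis_graft: "uea_basis (graft_basis a b) = uea_vee (uea_basis a) (uea_basis b)"
  by (simp add: uea_vee_class)

lemma bilinear_uea_vee: "bilinear uea_vee"
proof (rule bilinearI)
  fix u :: "'a uea"
  show "linear (uea_vee u)"
  proof (rule linearI)
    fix v w :: "'a uea" and r
    obtain p q s where u: "u = uea_class p" "v = uea_class q" "w = uea_class s"
      by (metis uea_class_rep)
    show "uea_vee u (v + w) = uea_vee u v + uea_vee u w"
      by (simp add: u uea_vee_class linear_add[OF linear_uea_class, symmetric] bilinear_radd[OF bilinear_vee])
    show "uea_vee u (r *\<^sub>R v) = r *\<^sub>R uea_vee u v"
      by (simp add: u uea_vee_class linear_scale[OF linear_uea_class, symmetric] bilinear_rmul[OF bilinear_vee])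
  qed
next
  fix u :: "'a uea"
  show "linear (\<lambda>v. uea_vee v u)"
  proof (rule linearI)
    fix v w :: "'a uea" and r
    obtain p q s where u: "u = uea_class p" "v = uea_class q" "w = uea_class s"
      by (metis uea_class_rep)
    show "uea_vee (v + w) u = uea_vee v u + uea_vee w u"
      by (simp add: u uea_vee_class linear_add[OF linear_uea_class, symmetric] bilinear_ladd[OF bilinear_vee])
    show "uea_vee (r *\<^sub>R v) u = r *\<^sub>R uea_vee v u"
      by (simp add: u uea_vee_class linear_scale[OF linear_uea_class, symmetric] bilinear_lmul[OF bilinear_vee])
  qed
qed

text \<open>
  Grafting the unit is \<open>\<alpha>\<close>, which is why the properties of \<open>\<alpha>\<close> are special cases of those of the
  multiplication.
\<close>

lemma uea_vee_unit: "uea_vee u uea_unit = uea_alpha u" "uea_vee uea_unit u = uea_alpha u"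
  by (metis uea_class_rep uea_vee_class vee_None uea_unit_def uea_alpha_def)+

lemma uea_alpha_unit: "uea_alpha uea_unit = uea_unit"
  by (simp add: uea_vee_unit(1)[symmetric] uea_unit_def uea_vee_class)

lemma linear_uea_alpha: "linear uea_alpha"
  using bilinear_linear_left[OF bilinear_uea_vee linear_id', of uea_unit] by (simp add: uea_vee_unit)

lemma uea_alpha_class: "uea_alpha (uea_class p) = uea_class (alpha p)"
  by (metis uea_vee_unit(1) uea_vee_class vee_None(1) uea_unit_def)

lemma uea_alpha_vee: "uea_alpha (uea_vee u v) = uea_vee (uea_alpha u) (uea_alpha v)"
  by (metis uea_alpha_class uea_class_rep uea_vee_class alpha_vee)

lemma uea_hom_assoc: "uea_vee (uea_vee u v) (uea_alpha w) = uea_vee (uea_alpha u) (uea_vee v w)"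
proof -
  let ?A = "\<lambda>p q r. vee (vee p q) (alpha r) - vee (alpha p) (vee q r)"
  have sub: "subspace {p. uea_class p = 0}" by (rule linear_subspace_kernel[OF linear_uea_class])
  have 1: "linear (\<lambda>p. ?A p q r)" "linear (\<lambda>q. ?A p q r)" "linear (\<lambda>r. ?A p q r)"
    for p q r :: "'a forest"
    by (rule linearI; simp add: bilinear_ladd[OF bilinear_vee] bilinear_radd[OF bilinear_vee]
        bilinear_lmul[OF bilinear_vee] bilinear_rmul[OF bilinear_vee]
        linear_add[OF linear_alpha] linear_scale[OF linear_alpha] scaleR_diff_right)+
  have 2: "r \<in> {r. ?A (basis_vec a) (basis_vec b) r \<in> {p. uea_class p = 0}}" for a b and r :: "'a forest"
    by (rule subspace_basis_UNIV[OF subspace_linear_vimage[OF 1(3) sub]])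
      (use uea_class_hom_associator in blast)
  have 3: "q \<in> {q. ?A (basis_vec a) q r \<in> {p. uea_class p = 0}}" for a and q r :: "'a forest"
    by (rule subspace_basis_UNIV[OF subspace_linear_vimage[OF 1(2) sub]]) (use 2 in blast)
  have "p \<in> {p. ?A p q r \<in> {p. uea_class p = 0}}" for p q r :: "'a forest"
    by (rule subspace_basis_UNIV[OF subspace_linear_vimage[OF 1(1) sub]]) (use 3 in blast)
  then have "uea_class (?A p q r) = 0" for p q r :: "'a forest" by blast
  then have "uea_class (vee (vee p q) (alpha r)) = uea_class (vee (alpha p) (vee q r))" for p q r :: "'a forest"
    by (metis linear_diff[OF linear_uea_class] eq_iff_diff_eq_0)
  then show ?thesis by (metis uea_class_rep uea_vee_class uea_alpha_class)
qed

section \<open>Descent of structure maps\<close>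

text \<open>
  A map that is multiplicative for some product \<open>m\<close> has an ideal as kernel, so by minimality of the
  kernel of the projection it factors through the enveloping algebra as soon as it respects the
  generating relations.  The product \<open>m\<close> is arbitrary in order to cover the antipode, for which it is
  the opposite multiplication.
\<close>

lemma uea_descend:
  fixes F :: "'g::hom_lie_algebra forest \<Rightarrow> 'v::real_vector"
  assumes F: "linear F" and m: "bilinear m" and mult: "\<And>p q. F (vee p q) = m (F p) (F q)"
    and leaf: "\<And>n. linear (\<lambda>x. F (uea_leaf n x))"
    and assoc: "\<And>a b c. F (vee (vee (basis_vec a) (basis_vec b)) (alpha (basis_vec c)))
      = F (vee (alpha (basis_vec a)) (vee (basis_vec b) (basis_vec c)))"
    and twist: "\<And>n x. F (uea_leaf n x) = F (uea_leaf 0 ((htwist ^^ n) x))"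
    and bracket: "\<And>x y. F (vee (uea_leaf 0 x) (uea_leaf 0 y)) - F (vee (uea_leaf 0 y) (uea_leaf 0 x))
        = F (uea_leaf 0 (hbracket x y))"
  shows "F (uea_rep (uea_class p)) = F p"
proof -
  note lin = linear_diff[OF F] linear_scale[OF F]
  have ideal: "two_sided_ideal vee {p. F p = 0}"
    unfolding two_sided_ideal_def
    by (auto simp: mult linear_subspace_kernel[OF F] bilinear_lzero[OF m] bilinear_rzero[OF m])
  have "uea_rep (uea_class p) - p \<in> {p. F p = 0}"
  proof (rule uea_kernel_minimal[OF ideal])
    show "uea_class (uea_rep (uea_class p) - p) = 0"
      by (simp add: linear_diff[OF linear_uea_class])
    show "hom_associator a b c \<in> {p. F p = 0}" for a b c
      unfolding mem_Collect_eq linear_diff[OF F] assoc by simp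
    show "vee (uea_leaf 0 x) (uea_leaf 0 y) - vee (uea_leaf 0 y) (uea_leaf 0 x)
        - uea_leaf 0 (hbracket x y) \<in> {p. F p = 0}" for x y
      unfolding mem_Collect_eq linear_diff[OF F] bracket by simp
    show "uea_leaf n x - uea_leaf 0 ((htwist ^^ n) x) \<in> {p. F p = 0}" for n x
      unfolding mem_Collect_eq linear_diff[OF F] twist[of n x] by simp
    show "uea_leaf a (x + y) - uea_leaf a x - uea_leaf a y \<in> {p. F p = 0}" for a x y
      by (simp add: lin linear_add[OF leaf])
    show "uea_leaf a (r *\<^sub>R x) - r *\<^sub>R uea_leaf a x \<in> {p. F p = 0}" for a r x
      by (simp add: lin linear_scale[OF leaf])
  qed
  then show ?thesis by (simp add: lin)
qed

section \<open>Counit and antipode\<close>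

lemma linear_counit: "linear counit"
  by (rule linearI) (simp_all add: counit_def lookup_add lookup_scaleR)

lemma counit_basis_vec: "counit (basis_vec b) = (if b = None then 1 else 0)"
  by (simp add: counit_def lookup_basis_vec)

lemma counit_vee: "counit (vee p q) = counit p * counit q"
proof (rule bilinear_eq_on_basis_vec[of "\<lambda>p q. counit (vee p q)" "\<lambda>p q. counit p * counit q"])
  show "bilinear (\<lambda>p q::'a forest. counit (vee p q))"
    by (rule bilinear_linear_compose[OF bilinear_vee linear_counit])
  show "bilinear (\<lambda>p q::'a forest. counit p * counit q)"
    by (rule bilinear_compose_linear2[OF bilinear_times linear_counit linear_counit])
  show "counit (vee (basis_vec a) (basis_vec b)) = counit (basis_vec a) * counit (basis_vec b)"
    for a b :: "'a wtree option"
    by (cases a; cases b) (auto simp: counit_basis_vec)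
qed

lemma uea_counit_class: "uea_counit (uea_class p) = counit p"
  unfolding uea_counit_def
proof (rule uea_descend[OF linear_counit bilinear_times counit_vee])
  show "linear (\<lambda>x::'a. counit (uea_leaf n x))" for n
    by (rule linearI) (simp_all add: counit_basis_vec)
qed (simp_all only: counit_vee vee_None(1)[symmetric], simp_all add: counit_basis_vec)

lemma linear_uea_counit: "linear uea_counit"
proof (rule linearI)
  fix u v :: "'a uea" and r
  obtain p q where u: "u = uea_class p" "v = uea_class q" by (metis uea_class_rep)
  show "uea_counit (u + v) = uea_counit u + uea_counit v"
    by (simp add: u uea_counit_class linear_add[OF linear_uea_class, symmetric] linear_add[OF linear_counit])
  show "uea_counit (r *\<^sub>R u) = r *\<^sub>R uea_counit u"
    by (simp only: u uea_counit_class linear_scale[OF linear_uea_class, symmetric] linear_scale[OF linear_counit])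
qed

lemma uea_counit_vee: "uea_counit (uea_vee u v) = uea_counit u * uea_counit v"
  by (metis uea_class_rep uea_vee_class uea_counit_class counit_vee)

lemma linear_antipode: "linear antipode"
  unfolding antipode_def by (rule linear_lin_ext)

lemma antipode_basis_vec: "antipode (basis_vec None) = basis_vec None"
  "antipode (basis_vec (Some t)) = antipode_wtree t"
  by (simp_all add: antipode_def)

lemma antipode_wtree_shift: "antipode_wtree (shift t) = alpha (antipode_wtree t)"
  by (induction t) (simp_all add: alpha_vee linear_neg[OF linear_alpha])

text \<open>
  For two trees this is the definition of the antipode.  If a factor is \<open>\<one>\<close>, it says that the antipode
  commutes with shifting the weights.
\<close>

lemma antipode_vee: "antipode (vee p q) = vee (antipode q) (antipode p)"
proof (rule bilinear_eq_on_basis_vec[of "\<lambda>p q. antipode (vee p q)" "\<lambda>p q. vee (antipode q) (antipode p)"])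
  show "bilinear (\<lambda>p q::'a forest. antipode (vee p q))"
    by (rule bilinear_linear_compose[OF bilinear_vee linear_antipode])
  show "bilinear (\<lambda>p q::'a forest. vee (antipode q) (antipode p))"
    by (intro bilinearI bilinear_linear_left[OF bilinear_vee linear_antipode]
        bilinear_linear_right[OF bilinear_vee linear_antipode])
  show "antipode (vee (basis_vec a) (basis_vec b)) = vee (antipode (basis_vec b)) (antipode (basis_vec a))"
    for a b :: "'a wtree option"
    by (cases a; cases b) (auto simp: antipode_basis_vec antipode_wtree_shift vee_None)
qed

text \<open>
  The antipode is multiplicative for the opposite product, which is Hom-associative too.  It is \<open>-1\<close>
  on leaves and exchanges \<open>x \<or> y\<close> with \<open>y \<or> x\<close>, so both sides of the commutator relation change
  their sign.
\<close>

lemma uea_antipode_class: "uea_antipode (uea_class p) = uea_class (antipode p)"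
proof -
  let ?F = "\<lambda>p. uea_class (antipode p)"
  have "?F (uea_rep (uea_class p)) = ?F p"
  proof (rule uea_descend[where m = "\<lambda>u v. uea_vee v u"])
    show "linear ?F" by (rule linear_compose_fun[OF linear_uea_class linear_antipode])
    show "bilinear (\<lambda>u v::'a uea. uea_vee v u)"
      using bilinear_uea_vee unfolding bilinear_def by blast
    show "?F (vee p q) = uea_vee (?F q) (?F p)" for p q :: "'a forest"
      by (simp add: antipode_vee uea_vee_class)
    show "linear (\<lambda>x. ?F (uea_leaf n x))" for n
      using linear_compose_neg[OF uea_class_leaf_linear]
      by (simp add: antipode_basis_vec linear_neg[OF linear_uea_class])
    show "?F (uea_leaf n x) = ?F (uea_leaf 0 ((htwist ^^ n) x))" for n and x :: 'a
      by (simp add: antipode_basis_vec linear_neg[OF linear_uea_class] uea_class_twist[of n])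
    show "?F (vee (vee (basis_vec a) (basis_vec b)) (alpha (basis_vec c)))
      = ?F (vee (alpha (basis_vec a)) (vee (basis_vec b) (basis_vec c)))" for a b c :: "'a wtree option"
      by (simp only: antipode_vee vee_None(1)[symmetric] antipode_basis_vec)
        (simp only: uea_vee_class[symmetric] vee_None uea_alpha_class[symmetric] uea_hom_assoc)
    show "?F (vee (uea_leaf 0 x) (uea_leaf 0 y)) - ?F (vee (uea_leaf 0 y) (uea_leaf 0 x))
        = ?F (uea_leaf 0 (hbracket x y))" for x y :: 'a
      unfolding antipode_vee antipode_basis_vec antipode_wtree.simps
        bilinear_lneg[OF bilinear_vee] bilinear_rneg[OF bilinear_vee] minus_minus linear_neg[OF linear_uea_class]
      unfolding uea_class_bracket[symmetric] by simp
  qed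
  then show ?thesis by (simp add: uea_antipode_def)
qed

lemma linear_uea_antipode: "linear uea_antipode"
proof (rule linearI)
  fix u v :: "'a uea" and r
  obtain p q where u: "u = uea_class p" "v = uea_class q" by (metis uea_class_rep)
  show "uea_antipode (u + v) = uea_antipode u + uea_antipode v"
    by (simp add: u uea_antipode_class linear_add[OF linear_uea_class, symmetric] linear_add[OF linear_antipode])
  show "uea_antipode (r *\<^sub>R u) = r *\<^sub>R uea_antipode u"
    by (simp only: u uea_antipode_class linear_scale[OF linear_uea_class, symmetric] linear_scale[OF linear_antipode])
qed

lemma uea_antipode_vee: "uea_antipode (uea_vee u v) = uea_vee (uea_antipode v) (uea_antipode u)"
  by (metis uea_class_rep uea_vee_class uea_antipode_class antipode_vee)

section \<open>Comultiplication\<close>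

text \<open>
  The componentwise product \<open>(a \<otimes> b) (c \<otimes> d) = m a c \<otimes> m b d\<close>.
\<close>

definition tensor_mult :: "('a \<Rightarrow> 'a \<Rightarrow> 'a) \<Rightarrow> ('a::real_vector, 'a) tensor \<Rightarrow> ('a, 'a) tensor \<Rightarrow> ('a, 'a) tensor"
  where "tensor_mult m s t = tensor_lift (\<lambda>a b. tensor_lift (\<lambda>c d. m a c \<otimes> m b d) t) s"

lemma
  assumes m: "bilinear m"
  shows bilinear_tensor_mult: "bilinear (tensor_mult m)"
    and tensor_mult_tensor: "tensor_mult m (a \<otimes> b) (c \<otimes> d) = m a c \<otimes> m b d"
proof -
  have inner: "bilinear (\<lambda>c d. m a c \<otimes> m b d)" for a b
    using m by (intro bilinear_tensor_of_linear) (auto simp: bilinear_def)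
  have lin: "linear (tensor_lift (\<lambda>c d. m a c \<otimes> m b d))" for a b
    by (rule linear_tensor_lift[OF inner])
  note expand = bilinear_ladd[OF m] bilinear_lmul[OF m] bilinear_ladd[OF bilinear_tensor]
    bilinear_radd[OF bilinear_tensor] bilinear_lmul[OF bilinear_tensor] bilinear_rmul[OF bilinear_tensor]
  have outer: "bilinear (\<lambda>a b. tensor_lift (\<lambda>c d. m a c \<otimes> m b d) t)" for t
  proof (intro bilinearI linearI)
    fix a b b' r
    show "tensor_lift (\<lambda>c d. m a c \<otimes> m (b + b') d) t
      = tensor_lift (\<lambda>c d. m a c \<otimes> m b d) t + tensor_lift (\<lambda>c d. m a c \<otimes> m b' d) t"
      by (rule linear_eq_on_tensor[OF lin linear_compose_add[OF lin lin]])
        (simp only: tensor_lift_tensor[OF inner], simp only: expand)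
    show "tensor_lift (\<lambda>c d. m a c \<otimes> m (r *\<^sub>R b) d) t = r *\<^sub>R tensor_lift (\<lambda>c d. m a c \<otimes> m b d) t"
      by (rule linear_eq_on_tensor[OF lin linear_compose_scale_right[OF lin]])
        (simp only: tensor_lift_tensor[OF inner], simp only: expand)
    show "tensor_lift (\<lambda>c d. m (b + b') c \<otimes> m a d) t
      = tensor_lift (\<lambda>c d. m b c \<otimes> m a d) t + tensor_lift (\<lambda>c d. m b' c \<otimes> m a d) t"
      by (rule linear_eq_on_tensor[OF lin linear_compose_add[OF lin lin]])
        (simp only: tensor_lift_tensor[OF inner], simp only: expand)
    show "tensor_lift (\<lambda>c d. m (r *\<^sub>R b) c \<otimes> m a d) t = r *\<^sub>R tensor_lift (\<lambda>c d. m b c \<otimes> m a d) t"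
      by (rule linear_eq_on_tensor[OF lin linear_compose_scale_right[OF lin]])
        (simp only: tensor_lift_tensor[OF inner], simp only: expand)
  qed
  show "tensor_mult m (a \<otimes> b) (c \<otimes> d) = m a c \<otimes> m b d"
    unfolding tensor_mult_def tensor_lift_tensor[OF outer] by (rule tensor_lift_tensor[OF inner])
  show "bilinear (tensor_mult m)"
  proof (rule bilinearI)
    show "linear (\<lambda>s. tensor_mult m s t)" for t
      unfolding tensor_mult_def by (rule linear_tensor_lift[OF outer])
    show "linear (tensor_mult m s)" for s
    proof (rule linearI)
      fix t t' r
      show "tensor_mult m s (t + t') = tensor_mult m s t + tensor_mult m s t'"
        unfolding tensor_mult_def
        by (rule linear_eq_on_tensor[OF linear_tensor_lift[OF outer]
              linear_compose_add[OF linear_tensor_lift[OF outer] linear_tensor_lift[OF outer]]])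
          (simp only: tensor_lift_tensor[OF outer], simp only: linear_add[OF lin])
      show "tensor_mult m s (r *\<^sub>R t) = r *\<^sub>R tensor_mult m s t"
        unfolding tensor_mult_def
        by (rule linear_eq_on_tensor[OF linear_tensor_lift[OF outer]
              linear_compose_scale_right[OF linear_tensor_lift[OF outer]]])
          (simp only: tensor_lift_tensor[OF outer], simp only: linear_scale[OF lin])
    qed
  qed
qed

abbreviation uea_tensor_vee where "uea_tensor_vee \<equiv> tensor_mult uea_vee"

lemmas bilinear_uea_tensor_vee = bilinear_tensor_mult[OF bilinear_uea_vee]
lemmas uea_tensor_vee_tensor = tensor_mult_tensor[OF bilinear_uea_vee]

lemma uea_tensor_hom_assoc:
  "uea_tensor_vee (uea_tensor_vee s t) (tensor_map uea_alpha uea_alpha u)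
    = uea_tensor_vee (tensor_map uea_alpha uea_alpha s) (uea_tensor_vee t u)"
proof -
  let ?m = "uea_tensor_vee" and ?\<alpha> = "tensor_map uea_alpha uea_alpha"
  note \<alpha> = linear_tensor_map[OF linear_uea_alpha linear_uea_alpha]
  note left = bilinear_linear_left[OF bilinear_uea_tensor_vee]
  note right = bilinear_linear_right[OF bilinear_uea_tensor_vee]
  have 1: "?m (?m (a \<otimes> b) (c \<otimes> d)) (?\<alpha> u) = ?m (?\<alpha> (a \<otimes> b)) (?m (c \<otimes> d) u)" for a b c d :: "'a uea" and u
    by (rule linear_eq_on_tensor[OF right[OF \<alpha>] right[OF right[OF linear_id']]])
      (simp add: uea_tensor_vee_tensor tensor_map_tensor linear_uea_alpha uea_hom_assoc)
  have 2: "?m (?m (a \<otimes> b) t) (?\<alpha> u) = ?m (?\<alpha> (a \<otimes> b)) (?m t u)" for a b :: "'a uea" and t u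
    by (rule linear_eq_on_tensor[OF left[OF right[OF linear_id']] right[OF left[OF linear_id']]]) (rule 1)
  show ?thesis
    by (rule linear_eq_on_tensor[OF left[OF left[OF linear_id']] left[OF \<alpha>]]) (rule 2)
qed

lemma uea_tensor_vee_unit: "uea_tensor_vee s (uea_unit \<otimes> uea_unit) = tensor_map uea_alpha uea_alpha s"
  "uea_tensor_vee (uea_unit \<otimes> uea_unit) s = tensor_map uea_alpha uea_alpha s"
proof -
  note \<alpha> = linear_tensor_map[OF linear_uea_alpha linear_uea_alpha]
  show "uea_tensor_vee s (uea_unit \<otimes> uea_unit) = tensor_map uea_alpha uea_alpha s"
    by (rule linear_eq_on_tensor[OF bilinear_linear_left[OF bilinear_uea_tensor_vee linear_id'] \<alpha>])
      (simp add: uea_tensor_vee_tensor tensor_map_tensor linear_uea_alpha uea_vee_unit)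
  show "uea_tensor_vee (uea_unit \<otimes> uea_unit) s = tensor_map uea_alpha uea_alpha s"
    by (rule linear_eq_on_tensor[OF bilinear_linear_right[OF bilinear_uea_tensor_vee linear_id'] \<alpha>])
      (simp add: uea_tensor_vee_tensor tensor_map_tensor linear_uea_alpha uea_vee_unit)
qed

lemma prune_cong:
  "I \<inter> {1..num_leaves t} = I' \<inter> {1..num_leaves t} \<Longrightarrow> prune I t = prune I' t"
proof (induction t arbitrary: I I')
  case (Leaf a x)
  then have "1 \<in> I \<longleftrightarrow> 1 \<in> I'" by auto
  then show ?case by simp
next
  case (Graft l r)
  have "i \<in> I \<longleftrightarrow> i \<in> I'" if "1 \<le> i" "i \<le> num_leaves l + num_leaves r" for i
    using Graft.prems that by (auto simp: set_eq_iff)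
  then have "prune I l = prune I' l"
    "prune {i. i + num_leaves l \<in> I} r = prune {i. i + num_leaves l \<in> I'} r"
    by (intro Graft.IH; auto)+
  then show ?case by simp
qed

lemma prune_shift: "prune I (shift t) = map_option shift (prune I t)"
  by (induction t arbitrary: I) (auto simp: shift_graft_basis)

text \<open>
  The identity \<open>(\<phi> \<or> \<psi>)\<^sub>I = \<phi>\<^sub>A \<or> \<psi>\<^sub>B\<close>, where a set of leaves \<open>I\<close> of a graft is given by a set \<open>A\<close> of
  leaves of the left and a set \<open>B\<close> of leaves of the right factor, and the same for the complements.
\<close>

lemma prune_Graft_union:
  assumes "A \<subseteq> {1..num_leaves l}" "B \<subseteq> {1..num_leaves r}"
  shows "prune (A \<union> (\<lambda>i. i + num_leaves l) ` B) (Graft l r) = graft_basis (prune A l) (prune B r)"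
    and "prune ({1..num_leaves (Graft l r)} - (A \<union> (\<lambda>i. i + num_leaves l) ` B)) (Graft l r)
      = graft_basis (prune ({1..num_leaves l} - A) l) (prune ({1..num_leaves r} - B) r)"
proof -
  let ?I = "A \<union> (\<lambda>i. i + num_leaves l) ` B"
  have "prune ?I l = prune A l" "prune {i. i + num_leaves l \<in> ?I} r = prune B r"
    using assms by (intro prune_cong; auto)+
  then show "prune ?I (Graft l r) = graft_basis (prune A l) (prune B r)" by simp
  let ?J = "{1..num_leaves (Graft l r)} - ?I"
  have "prune ?J l = prune ({1..num_leaves l} - A) l"
    "prune {i. i + num_leaves l \<in> ?J} r = prune ({1..num_leaves r} - B) r"
    using assms by (intro prune_cong; auto)+
  then show "prune ?J (Graft l r) = graft_basis (prune ({1..num_leaves l} - A) l) (prune ({1..num_leaves r} - B) r)"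
    by simp
qed

lemma sum_Pow_add:
  fixes g :: "nat set \<Rightarrow> 'v::comm_monoid_add"
  shows "(\<Sum>I\<in>Pow {1..m + n}. g I) = (\<Sum>A\<in>Pow {1..m}. \<Sum>B\<in>Pow {1..n}. g (A \<union> (\<lambda>i. i + m) ` B))"
proof -
  have *: "A \<inter> {1..m} \<union> (\<lambda>i. i + m) ` {i \<in> {1..n}. i + m \<in> A} = A" if "A \<subseteq> {1..m + n}" for A
  proof (intro equalityI subsetI)
    fix i assume i: "i \<in> A"
    show "i \<in> A \<inter> {1..m} \<union> (\<lambda>i. i + m) ` {i \<in> {1..n}. i + m \<in> A}"
    proof (cases "i \<le> m")
      case True
      then show ?thesis using i that by auto
    next
      case False
      then show ?thesis using i that by (intro UnI2 image_eqI[of _ _ "i - m"]) auto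
    qed
  qed auto
  show ?thesis
    unfolding sum.cartesian_product
    by (rule sum.reindex_bij_witness[where j = "\<lambda>I. (I \<inter> {1..m}, {i \<in> {1..n}. i + m \<in> I})"
          and i = "\<lambda>(A, B). A \<union> (\<lambda>i. i + m) ` B"])
      (use * in \<open>auto simp del: One_nat_def\<close>)
qed

text \<open>
  The comultiplication of forests with both tensor factors projected to the enveloping algebra, in
  other words the map that has to be shown to descend.
\<close>

definition uea_coproduct :: "'g::hom_lie_algebra forest \<Rightarrow> ('g uea, 'g uea) tensor"
  where "uea_coproduct p = tensor_map uea_class uea_class (comult p)"

lemma linear_uea_coproduct: "linear uea_coproduct"
  unfolding uea_coproduct_def comult_def
  by (rule linear_compose_fun[OF linear_tensor_map[OF linear_uea_class linear_uea_class] linear_lin_ext])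

lemma uea_coproduct_None: "uea_coproduct (basis_vec None) = uea_unit \<otimes> uea_unit"
  by (simp add: uea_coproduct_def comult_def tensor_map_tensor linear_uea_class uea_unit_def)

lemma uea_coproduct_Some:
  "uea_coproduct (basis_vec (Some t)) =
    (\<Sum>I\<in>Pow {1..num_leaves t}. uea_basis (prune I t) \<otimes> uea_basis (prune ({1..num_leaves t} - I) t))"
  by (simp add: uea_coproduct_def comult_def linear_sum[OF linear_tensor_map[OF linear_uea_class linear_uea_class]]
      tensor_map_tensor linear_uea_class)

lemma uea_coproduct_shift:
  "uea_coproduct (basis_vec (Some (shift t))) = tensor_map uea_alpha uea_alpha (uea_coproduct (basis_vec (Some t)))"
  by (simp add: uea_coproduct_Some linear_sum[OF linear_tensor_map[OF linear_uea_alpha linear_uea_alpha]]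
      tensor_map_tensor linear_uea_alpha uea_alpha_class prune_shift)

text \<open>
  A splitting of the leaves of a graft is a pair of splittings of the leaves of its factors, which
  makes the comultiplication multiplicative.
\<close>

lemma uea_coproduct_Graft:
  "uea_coproduct (basis_vec (Some (Graft l r)))
    = uea_tensor_vee (uea_coproduct (basis_vec (Some l))) (uea_coproduct (basis_vec (Some r)))"
proof -
  let ?m = "num_leaves l" and ?n = "num_leaves r"
  let ?c = "\<lambda>t I. uea_basis (prune I t) \<otimes> uea_basis (prune ({1..num_leaves t} - I) t)"
  have "uea_coproduct (basis_vec (Some (Graft l r))) = (\<Sum>I\<in>Pow {1..?m + ?n}. ?c (Graft l r) I)"
    by (simp only: uea_coproduct_Some num_leaves.simps)
  also have "\<dots> = (\<Sum>A\<in>Pow {1..?m}. \<Sum>B\<in>Pow {1..?n}. ?c (Graft l r) (A \<union> (\<lambda>i. i + ?m) ` B))"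
    by (rule sum_Pow_add)
  also have "\<dots> = (\<Sum>A\<in>Pow {1..?m}. \<Sum>B\<in>Pow {1..?n}. uea_tensor_vee (?c l A) (?c r B))"
    by (intro sum.cong refl) (simp only: Pow_iff prune_Graft_union uea_basis_graft uea_tensor_vee_tensor)
  also have "\<dots> = uea_tensor_vee (\<Sum>A\<in>Pow {1..?m}. ?c l A) (\<Sum>B\<in>Pow {1..?n}. ?c r B)"
    by (simp add: bilinear_sum[OF bilinear_uea_tensor_vee] sum.cartesian_product)
  finally show ?thesis by (simp only: uea_coproduct_Some)
qed

lemma uea_coproduct_vee: "uea_coproduct (vee p q) = uea_tensor_vee (uea_coproduct p) (uea_coproduct q)"
proof (rule bilinear_eq_on_basis_vec[of "\<lambda>p q. uea_coproduct (vee p q)"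
      "\<lambda>p q. uea_tensor_vee (uea_coproduct p) (uea_coproduct q)"])
  show "bilinear (\<lambda>p q::'a forest. uea_coproduct (vee p q))"
    by (rule bilinear_linear_compose[OF bilinear_vee linear_uea_coproduct])
  show "bilinear (\<lambda>p q::'a forest. uea_tensor_vee (uea_coproduct p) (uea_coproduct q))"
    by (rule bilinear_compose_linear2[OF bilinear_uea_tensor_vee linear_uea_coproduct linear_uea_coproduct])
  show "uea_coproduct (vee (basis_vec a) (basis_vec b))
      = uea_tensor_vee (uea_coproduct (basis_vec a)) (uea_coproduct (basis_vec b))" for a b :: "'a wtree option"
    by (cases a; cases b)
      (simp_all add: uea_coproduct_None uea_coproduct_Graft uea_coproduct_shift uea_tensor_vee_unit
        tensor_map_tensor linear_uea_alpha uea_vee_unit uea_alpha_unit)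
qed

lemma uea_coproduct_leaf:
  "uea_coproduct (uea_leaf n x) = uea_class (uea_leaf n x) \<otimes> uea_unit + uea_unit \<otimes> uea_class (uea_leaf n x)"
proof -
  have "Pow {1..1::nat} = {{}, {1}}" by auto
  then show ?thesis by (simp add: uea_coproduct_Some uea_unit_def)
qed

text \<open>
  Leaves are primitive, so a relation between leaves passes to the comultiplication at once.  In the
  commutator of two primitive elements the mixed terms \<open>\<alpha>(x) \<otimes> \<alpha>(y)\<close> and \<open>\<alpha>(y) \<otimes> \<alpha>(x)\<close> cancel.
\<close>

lemma uea_comult_class: "uea_comult (uea_class p) = uea_coproduct p"
proof -
  let ?l = "\<lambda>n x. uea_class (uea_leaf n x)"
  have "uea_coproduct (uea_rep (uea_class p)) = uea_coproduct p"
  proof (rule uea_descend[OF linear_uea_coproduct bilinear_uea_tensor_vee uea_coproduct_vee])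
    show "linear (\<lambda>x::'a. uea_coproduct (uea_leaf n x))" for n
      unfolding uea_coproduct_leaf
      by (intro linear_compose_add bilinear_linear_left[OF bilinear_tensor]
          bilinear_linear_right[OF bilinear_tensor] uea_class_leaf_linear)
    show "uea_coproduct (uea_leaf n x) = uea_coproduct (uea_leaf 0 ((htwist ^^ n) x))" for n and x :: 'a
      unfolding uea_coproduct_leaf uea_class_twist[of n x] by simp
    show "uea_coproduct (vee (vee (basis_vec a) (basis_vec b)) (alpha (basis_vec c)))
      = uea_coproduct (vee (alpha (basis_vec a)) (vee (basis_vec b) (basis_vec c)))" for a b c :: "'a wtree option"
      by (simp only: vee_None(1)[symmetric] uea_coproduct_vee uea_coproduct_None uea_tensor_vee_unit
          uea_tensor_hom_assoc)
    show "uea_coproduct (vee (uea_leaf 0 x) (uea_leaf 0 y)) - uea_coproduct (vee (uea_leaf 0 y) (uea_leaf 0 x))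
        = uea_coproduct (uea_leaf 0 (hbracket x y))" for x y :: 'a
      unfolding uea_coproduct_vee uea_coproduct_leaf uea_class_bracket[symmetric]
      by (simp add: bilinear_ladd[OF bilinear_uea_tensor_vee] bilinear_radd[OF bilinear_uea_tensor_vee]
          uea_tensor_vee_tensor uea_vee_unit uea_vee_class[symmetric] del: vee_basis_vec)
        (simp add: bilinear_lsub[OF bilinear_tensor] bilinear_rsub[OF bilinear_tensor]
          linear_uea_alpha uea_alpha_class uea_unit_def vee_None)
  qed
  then show ?thesis by (simp add: uea_comult_def uea_coproduct_def)
qed

lemma linear_uea_comult: "linear uea_comult"
proof (rule linearI)
  fix u v :: "'a uea" and r
  obtain p q where u: "u = uea_class p" "v = uea_class q" by (metis uea_class_rep)
  show "uea_comult (u + v) = uea_comult u + uea_comult v"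
    by (simp only: u uea_comult_class linear_add[OF linear_uea_class, symmetric] linear_add[OF linear_uea_coproduct])
  show "uea_comult (r *\<^sub>R u) = r *\<^sub>R uea_comult u"
    by (simp only: u uea_comult_class linear_scale[OF linear_uea_class, symmetric] linear_scale[OF linear_uea_coproduct])
qed

lemma uea_comult_vee: "uea_comult (uea_vee u v) = uea_tensor_vee (uea_comult u) (uea_comult v)"
  by (metis uea_class_rep uea_vee_class uea_comult_class uea_coproduct_vee)

section \<open>Powers of an element\<close>

text \<open>
  The class of the right comb with \<open>n\<close> leaves \<open>x\<close>, the weight of a leaf being \<open>q\<close> minus its distance
  from the top; no subtraction truncates for \<open>n \<le> q + 1\<close>.  The class \<open>\<lfloor>x\<^sup>i\<rfloor>\<^sub>p\<close> is
  \<open>hom_power x i (p - 1)\<close>, one unit being spent on the root edge.  A single leaf is its own top and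
  has weight \<open>q\<close> rather than \<open>q - 1\<close>.
\<close>

primrec hom_power :: "'g::hom_lie_algebra \<Rightarrow> nat \<Rightarrow> nat \<Rightarrow> 'g uea" where
  "hom_power x 0 q = uea_unit"
| "hom_power x (Suc n) q = (if n = 0 then uea_class (uea_leaf q x)
     else uea_vee (uea_class (uea_leaf (q - 1) x)) (hom_power x n (q - 1)))"

lemma uea_alpha_leaf: "uea_alpha (uea_class (uea_leaf q x)) = uea_class (uea_leaf (Suc q) x)"
  by (simp add: uea_alpha_class)

text \<open>
  At positive levels the case of a single leaf is no exception: grafting the unit raises the weight
  of the leaf from \<open>q\<close> to \<open>q + 1\<close>.
\<close>

lemma hom_power_Suc: "hom_power x (Suc n) (Suc q) = uea_vee (uea_class (uea_leaf q x)) (hom_power x n q)"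
  by (simp add: uea_vee_unit uea_alpha_leaf)

lemma uea_alpha_hom_power: "n \<le> Suc q \<Longrightarrow> uea_alpha (hom_power x n q) = hom_power x n (Suc q)"
proof (induction n arbitrary: q)
  case 0
  then show ?case by (simp add: uea_alpha_unit)
next
  case (Suc n)
  show ?case
  proof (cases q)
    case 0
    then show ?thesis using Suc.prems by (simp add: uea_alpha_leaf)
  next
    case (Suc r)
    then have "uea_alpha (hom_power x n r) = hom_power x n q" using Suc.IH[of r] Suc.prems by simp
    then show ?thesis
      unfolding Suc hom_power_Suc uea_alpha_vee uea_alpha_leaf by simp
  qed
qed

text \<open>
  The addition rule for exponents, which raises the level by one.  By Hom-associativity leaves can be
  moved one at a time from the left factor to the right one; the bounds say that none of the weights
  involved is truncated.
\<close>

lemma hom_power_vee: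
  assumes "m + n \<le> Suc (Suc q)" "m \<le> Suc q" "n \<le> Suc q"
  shows "uea_vee (hom_power x m q) (hom_power x n q) = hom_power x (m + n) (Suc q)"
  using assms
proof (induction m arbitrary: q)
  case 0
  then show ?case by (simp add: uea_vee_unit uea_alpha_hom_power)
next
  case (Suc m)
  show ?case
  proof (cases "m = 0")
    case True
    then show ?thesis using hom_power_Suc[of x n q] by simp
  next
    case False
    then obtain r where q: "q = Suc r" using Suc.prems by (cases q) auto
    (* With at least two leaves on the left, the right factor is alpha of a comb one level below:
       the form in which Hom-associativity applies. *)
    have n: "n \<le> Suc r" using Suc.prems False q by simp
    have "uea_vee (hom_power x (Suc m) q) (hom_power x n q)
        = uea_vee (uea_vee (uea_class (uea_leaf r x)) (hom_power x m r)) (uea_alpha (hom_power x n r))"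
      unfolding q hom_power_Suc uea_alpha_hom_power[OF n] ..
    also have "\<dots> = uea_vee (uea_class (uea_leaf q x)) (uea_vee (hom_power x m r) (hom_power x n r))"
      unfolding uea_hom_assoc uea_alpha_leaf q ..
    also have "uea_vee (hom_power x m r) (hom_power x n r) = hom_power x (m + n) q"
      unfolding q by (rule Suc.IH) (use Suc.prems n q in auto)
    finally show ?thesis by (simp only: hom_power_Suc add_Suc)
  qed
qed

text \<open>
  A unit of weight on a leaf is the same as one application of the twist to its decoration.
\<close>

lemma hom_power_htwist: "n \<le> Suc q \<Longrightarrow> hom_power x n (Suc q) = hom_power (htwist x) n q"
proof (induction n arbitrary: q)
  case (Suc n)
  have leaf: "uea_class (uea_leaf (Suc r) x) = uea_class (uea_leaf r (htwist x))" for r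
    using uea_class_twist[of "Suc r" x] uea_class_twist[of r "htwist x"] by (simp add: funpow_swap1)
  show ?case
  proof (cases q)
    case 0
    then show ?thesis using Suc.prems by (simp add: leaf)
  next
    case (Suc r)
    then show ?thesis using Suc.IH[of r] Suc.prems by (simp only: hom_power_Suc leaf Suc_le_mono)
  qed
qed simp

lemma uea_antipode_unit: "uea_antipode uea_unit = uea_unit"
  by (simp add: uea_unit_def uea_antipode_class antipode_basis_vec)

lemma uea_antipode_leaf: "uea_antipode (uea_class (uea_leaf q x)) = - uea_class (uea_leaf q x)"
  by (simp add: uea_antipode_class antipode_basis_vec linear_neg[OF linear_uea_class])

text \<open>
  The antipode turns the right comb into a left comb with all leaves negated; the addition rule
  identifies left and right combs.
\<close>

lemma uea_antipode_hom_power: "n \<le> Suc q \<Longrightarrow> uea_antipode (hom_power x n q) = (-1) ^ n *\<^sub>R hom_power x n q"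
proof (induction n arbitrary: q)
  case 0
  then show ?case by (simp add: uea_antipode_unit)
next
  case (Suc n)
  show ?case
  proof (cases q)
    case 0
    then show ?thesis using Suc.prems by (simp add: uea_antipode_leaf)
  next
    case (Suc r)
    have "uea_antipode (hom_power x (Suc n) q) = (- ((-1) ^ n)) *\<^sub>R uea_vee (hom_power x n r) (hom_power x 1 r)"
      using Suc.IH[of r] Suc.prems Suc
      by (simp del: hom_power.simps add: hom_power_Suc uea_antipode_vee)
        (simp add: uea_antipode_leaf bilinear_lmul[OF bilinear_uea_vee] bilinear_rneg[OF bilinear_uea_vee])
    also have "uea_vee (hom_power x n r) (hom_power x 1 r) = hom_power x (n + 1) (Suc r)"
      by (rule hom_power_vee) (use Suc.prems Suc in auto)
    finally show ?thesis using Suc by (simp del: hom_power.simps)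
  qed
qed

lemma uea_counit_unit: "uea_counit uea_unit = 1"
  by (simp add: uea_unit_def uea_counit_class counit_basis_vec)

lemma uea_counit_hom_power: "uea_counit (hom_power x n q) = (if n = 0 then 1 else 0)"
  by (cases n) (simp_all add: uea_counit_unit uea_counit_class uea_counit_vee counit_basis_vec)

lemma uea_comult_unit: "uea_comult uea_unit = uea_unit \<otimes> uea_unit"
  by (simp add: uea_unit_def uea_comult_class uea_coproduct_None)

text \<open>
  Pascal's rule for binomial sums in a vector space.
\<close>

lemma sum_choose_Suc:
  fixes g :: "nat \<Rightarrow> 'v::real_vector"
  shows "(\<Sum>a\<le>Suc m. real (Suc m choose a) *\<^sub>R g a) = (\<Sum>a\<le>m. real (m choose a) *\<^sub>R (g (Suc a) + g a))"
proof -
  have "(\<Sum>a\<le>Suc m. real (Suc m choose a) *\<^sub>R g a)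
      = g 0 + (\<Sum>a\<le>m. real (m choose a) *\<^sub>R g (Suc a)) + (\<Sum>a\<le>m. real (m choose Suc a) *\<^sub>R g (Suc a))"
    unfolding sum.atMost_Suc_shift by (simp add: scaleR_add_left sum.distrib)
  also have "g 0 + (\<Sum>a\<le>m. real (m choose Suc a) *\<^sub>R g (Suc a)) = (\<Sum>a\<le>Suc m. real (m choose a) *\<^sub>R g a)"
    unfolding sum.atMost_Suc_shift by simp
  then have "g 0 + (\<Sum>a\<le>m. real (m choose a) *\<^sub>R g (Suc a)) + (\<Sum>a\<le>m. real (m choose Suc a) *\<^sub>R g (Suc a))
     = (\<Sum>a\<le>m. real (m choose a) *\<^sub>R g (Suc a)) + (\<Sum>a\<le>m. real (m choose a) *\<^sub>R g a)"
    by (simp add: algebra_simps)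
  finally show ?thesis by (simp add: scaleR_add_right sum.distrib)
qed

text \<open>
  As for powers of any primitive element: splitting off a leaf \<open>l\<close>, multiplication by
  \<open>l \<otimes> \<one> + \<one> \<otimes> l\<close> raises one tensor factor to the next power and applies \<open>\<alpha>\<close> to the other, which
  brings both to the next level.  The coefficients combine by Pascal's rule.
\<close>

lemma uea_comult_hom_power:
  "n \<le> Suc q \<Longrightarrow> uea_comult (hom_power x n q)
    = (\<Sum>a\<le>n. real (n choose a) *\<^sub>R (hom_power x a q \<otimes> hom_power x (n - a) q))"
proof (induction n arbitrary: q)
  case 0
  then show ?case by (simp add: uea_comult_unit)
next
  case (Suc n)
  have leaf: "uea_comult (uea_class (uea_leaf r x))
      = uea_class (uea_leaf r x) \<otimes> uea_unit + uea_unit \<otimes> uea_class (uea_leaf r x)" for r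
    by (simp only: uea_comult_class uea_coproduct_leaf)
  show ?case
  proof (cases q)
    case 0
    then show ?thesis using Suc.prems by (simp add: leaf)
  next
    case (Suc r)
    let ?l = "uea_class (uea_leaf r x)"
    have n: "n \<le> Suc r" using Suc.prems Suc by simp
    note expand = bilinear_ladd[OF bilinear_uea_tensor_vee] bilinear_rmul[OF bilinear_uea_tensor_vee]
      uea_tensor_vee_tensor uea_vee_unit
    have step: "uea_tensor_vee (?l \<otimes> uea_unit + uea_unit \<otimes> ?l) (hom_power x a r \<otimes> hom_power x (n - a) r)
        = hom_power x (Suc a) q \<otimes> hom_power x (Suc n - Suc a) q + hom_power x a q \<otimes> hom_power x (Suc n - a) q"
      if "a \<le> n" for a
      using that n Suc
      by (simp del: hom_power.simps add: expand uea_alpha_hom_power Suc_diff_le hom_power_Suc)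
    have "uea_comult (hom_power x (Suc n) q) = uea_tensor_vee (?l \<otimes> uea_unit + uea_unit \<otimes> ?l)
        (\<Sum>a\<le>n. real (n choose a) *\<^sub>R (hom_power x a r \<otimes> hom_power x (n - a) r))"
      unfolding Suc hom_power_Suc uea_comult_vee leaf Suc.IH[OF n] ..
    also have "\<dots> = (\<Sum>a\<le>n. real (n choose a) *\<^sub>R
        (uea_tensor_vee (?l \<otimes> uea_unit + uea_unit \<otimes> ?l) (hom_power x a r \<otimes> hom_power x (n - a) r)))"
      unfolding linear_sum[OF bilinear_linear_right[OF bilinear_uea_tensor_vee linear_id']]
        bilinear_rmul[OF bilinear_uea_tensor_vee] ..
    also have "\<dots> = (\<Sum>a\<le>n. real (n choose a) *\<^sub>R
       (hom_power x (Suc a) q \<otimes> hom_power x (Suc n - Suc a) q + hom_power x a q \<otimes> hom_power x (Suc n - a) q))"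
      by (intro sum.cong refl) (simp only: atMost_iff step)
    finally show ?thesis by (simp only: sum_choose_Suc)
  qed
qed

lemma num_leaves_weigh: "num_leaves (weigh p d \<phi>) = num_tips \<phi>"
  by (induction \<phi> arbitrary: d) auto

lemma num_tips_pos: "num_tips \<phi> \<ge> 1"
  by (induction \<phi>) auto

text \<open>
  The class of a tree with these weights depends only on its number of leaves, because the addition
  rule applies at each node.
\<close>

lemma uea_class_weigh:
  "d + num_tips \<phi> \<le> Suc p \<Longrightarrow>
    uea_class (basis_vec (Some (decorate (weigh p d \<phi>) (replicate (num_tips \<phi>) x)))) = hom_power x (num_tips \<phi>) (p - d)"
proof (induction \<phi> arbitrary: d)
  case Tip
  then show ?case by simp
next
  case (Fork l r)
  let ?C = "\<lambda>d \<phi>. uea_class (basis_vec (Some (decorate (weigh p d \<phi>) (replicate (num_tips \<phi>) x))))"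
  have pos: "num_tips l \<ge> 1" "num_tips r \<ge> 1" by (rule num_tips_pos)+
  have "?C d (Fork l r) = uea_vee (?C (d + 1) l) (?C (d + 1) r)"
    by (simp add: uea_vee_class num_leaves_weigh)
  also have "\<dots> = uea_vee (hom_power x (num_tips l) (p - (d + 1))) (hom_power x (num_tips r) (p - (d + 1)))"
    using Fork pos by simp
  also have "\<dots> = hom_power x (num_tips l + num_tips r) (Suc (p - (d + 1)))"
    by (rule hom_power_vee) (use Fork.prems pos in auto)
  finally show ?case using Fork.prems pos by (simp add: Suc_diff_Suc)
qed

lemma trees_nonempty: "i \<ge> 1 \<Longrightarrow> \<exists>\<phi>. \<phi> \<in> trees i"
proof (induction i rule: dec_induct)
  case base
  show ?case by (rule exI[of _ Tip]) (simp add: trees_def)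
next
  case (step n)
  then obtain \<phi> where "\<phi> \<in> trees n" by blast
  then show ?case by (intro exI[of _ "Fork \<phi> Tip"]) (simp add: trees_def)
qed

lemma power_class_eq_hom_power:
  assumes "1 \<le> i" "i \<le> p"
  shows "power_class x i p = hom_power x i (p - 1)"
proof -
  let ?\<phi> = "SOME \<phi>. \<phi> \<in> trees i"
  have "num_tips ?\<phi> = i"
    using someI_ex[OF trees_nonempty[OF assms(1)]] by (simp add: trees_def)
  then show ?thesis
    using uea_class_weigh[of 1 ?\<phi> p x] assms by (simp add: power_class_def)
qed

section \<open>The exponential sequence\<close>

lemma coeff_poly_bilin:
  fixes m :: "'a::real_vector \<Rightarrow> 'b::real_vector \<Rightarrow> 'c::real_vector"
  assumes m: "bilinear m"
  shows "coeff (poly_bilin m f h) k = (\<Sum>i\<le>k. m (coeff f i) (coeff h (k - i)))"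
proof -
  note zero = bilinear_lzero[OF m] bilinear_rzero[OF m]
  have inner: "(\<Sum>j\<le>degree h. coeff (monom (m (coeff f i) (coeff h j)) (i + j)) k)
      = (if i \<le> k then m (coeff f i) (coeff h (k - i)) else 0)" for i
  proof -
    have "(\<Sum>j\<le>degree h. coeff (monom (m (coeff f i) (coeff h j)) (i + j)) k)
      = (\<Sum>j\<le>degree h. if j = k - i then (if i \<le> k then m (coeff f i) (coeff h (k - i)) else 0) else 0)"
      by (intro sum.cong) auto
    also have "\<dots> = (if i \<le> k then m (coeff f i) (coeff h (k - i)) else 0)"
      by (auto simp: zero coeff_eq_0)
    finally show ?thesis .
  qed
  have "coeff (poly_bilin m f h) k
      = (\<Sum>i\<le>degree f. if i \<le> k then m (coeff f i) (coeff h (k - i)) else 0)"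
    unfolding poly_bilin_def coeff_sum inner ..
  also have "\<dots> = (\<Sum>i\<le>max k (degree f). if i \<le> k then m (coeff f i) (coeff h (k - i)) else 0)"
    by (rule sum.mono_neutral_left) (auto simp: coeff_eq_0 zero)
  also have "\<dots> = (\<Sum>i\<le>k. m (coeff f i) (coeff h (k - i)))"
    by (rule sum.mono_neutral_cong_right) auto
  finally show ?thesis .
qed

text \<open>
  The unit is the zeroth power, so the constant term is not exceptional.
\<close>

lemma coeff_exp_hat:
  "coeff (exp_hat s x p) k = (if k \<le> p then (s ^ k / fact k) *\<^sub>R hom_power x k (p - 1) else 0)"
proof (cases k)
  case 0
  then show ?thesis by (simp add: exp_hat_def coeff_sum)
next
  case (Suc l)
  have "coeff (exp_hat s x p) k = (\<Sum>i=1..p. if i = k then (s ^ k / fact k) *\<^sub>R power_class x k p else 0)"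
    unfolding exp_hat_def coeff_add coeff_sum coeff_monom Suc
    by (auto simp: coeff_pCons intro!: sum.cong)
  also have "\<dots> = (if k \<le> p then (s ^ k / fact k) *\<^sub>R hom_power x k (p - 1) else 0)"
    using Suc by (simp add: power_class_eq_hom_power)
  finally show ?thesis .
qed

lemma exp_coefficient_convolution:
  "(\<Sum>i\<le>k. (s ^ i / fact i) * (t ^ (k - i) / fact (k - i))) = (s + t) ^ k / (fact k :: real)"
  unfolding binomial_ring sum_divide_distrib
  by (intro sum.cong refl) (simp add: binomial_fact)

lemma exp_coefficient_choose:
  "i \<le> k \<Longrightarrow> (s ^ k / fact k) * real (k choose i) = (s ^ i / fact i) * (s ^ (k - i) / (fact (k - i) :: real))"
  by (simp add: binomial_fact power_add[symmetric])

lemma group_like_exp_hat: "group_like p (exp_hat s x p)"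
  unfolding group_like_def
proof
  show "eq_mod_nu (p + 1) (map_poly uea_comult (exp_hat s x p)) (poly_bilin (\<otimes>) (exp_hat s x p) (exp_hat s x p))"
    unfolding eq_mod_nu_def
  proof (intro allI impI)
    fix k assume "k < p + 1"
    then have k: "k \<le> p" by simp
    have "coeff (map_poly uea_comult (exp_hat s x p)) k
        = (s ^ k / fact k) *\<^sub>R (\<Sum>i\<le>k. real (k choose i) *\<^sub>R (hom_power x i (p - 1) \<otimes> hom_power x (k - i) (p - 1)))"
      using k by (simp add: coeff_map_poly linear_0[OF linear_uea_comult] coeff_exp_hat
          linear_scale[OF linear_uea_comult] uea_comult_hom_power)
    also have "\<dots> = (\<Sum>i\<le>k. ((s ^ i / fact i) *\<^sub>R hom_power x i (p - 1)) \<otimes> ((s ^ (k - i) / fact (k - i)) *\<^sub>R hom_power x (k - i) (p - 1)))"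
      unfolding scaleR_sum_right scaleR_scaleR bilinear_lmul[OF bilinear_tensor] bilinear_rmul[OF bilinear_tensor]
      by (intro sum.cong refl, simp only: atMost_iff exp_coefficient_choose, simp only: mult.commute)
    also have "\<dots> = coeff (poly_bilin (\<otimes>) (exp_hat s x p) (exp_hat s x p)) k"
      unfolding coeff_poly_bilin[OF bilinear_tensor] using k
      by (intro sum.cong refl) (auto simp: coeff_exp_hat)
    finally show "coeff (map_poly uea_comult (exp_hat s x p)) k
      = coeff (poly_bilin (\<otimes>) (exp_hat s x p) (exp_hat s x p)) k" .
  qed
  show "map_poly uea_counit (exp_hat s x p) = 1"
    by (rule poly_eqI)
      (simp add: coeff_map_poly linear_0[OF linear_uea_counit] coeff_exp_hat
        linear_scale[OF linear_uea_counit] uea_counit_hom_power)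
qed

lemma seq_vee_exp_hat: "exp_hat s x \<squnion>\<^sub>G exp_hat t x \<doteq> seq_alpha (exp_hat (s + t) x)"
  unfolding seq_eq_def eq_mod_nu_def
proof (intro allI impI)
  fix p k :: nat assume "k < p + 1"
  then have k: "k \<le> p" by simp
  have "coeff ((exp_hat s x \<squnion>\<^sub>G exp_hat t x) p) k
      = (\<Sum>i\<le>k. ((s ^ i / fact i) * (t ^ (k - i) / fact (k - i))) *\<^sub>R hom_power x k (Suc (p - 1)))"
    unfolding seq_vee_def coeff_poly_bilin[OF bilinear_uea_vee]
  proof (intro sum.cong refl)
    fix i assume i: "i \<in> {..k}"
    then have "uea_vee (hom_power x i (p - 1)) (hom_power x (k - i) (p - 1)) = hom_power x (i + (k - i)) (Suc (p - 1))"
      using k by (intro hom_power_vee) auto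
    moreover have "i \<le> p" "k - i \<le> p" using i k by auto
    ultimately show "uea_vee (coeff (exp_hat s x p) i) (coeff (exp_hat t x p) (k - i))
      = ((s ^ i / fact i) * (t ^ (k - i) / fact (k - i))) *\<^sub>R hom_power x k (Suc (p - 1))"
      using i by (simp add: coeff_exp_hat bilinear_lmul[OF bilinear_uea_vee] bilinear_rmul[OF bilinear_uea_vee] mult.commute)
  qed
  also have "\<dots> = ((s + t) ^ k / fact k) *\<^sub>R hom_power x k (Suc (p - 1))"
    unfolding scaleR_sum_left[symmetric] exp_coefficient_convolution ..
  also have "\<dots> = coeff (seq_alpha (exp_hat (s + t) x) p) k"
    using k by (simp add: seq_alpha_def coeff_map_poly linear_0[OF linear_uea_alpha] coeff_exp_hat
        linear_scale[OF linear_uea_alpha] uea_alpha_hom_power)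
  finally show "coeff ((exp_hat s x \<squnion>\<^sub>G exp_hat t x) p) k = coeff (seq_alpha (exp_hat (s + t) x) p) k" .
qed

lemma seq_alpha_exp_hat: "seq_alpha (exp_hat s x) \<doteq> exp_hat s (htwist x)"
  unfolding seq_eq_def eq_mod_nu_def
  by (simp add: seq_alpha_def coeff_map_poly linear_0[OF linear_uea_alpha] coeff_exp_hat
      linear_scale[OF linear_uea_alpha] uea_alpha_hom_power hom_power_htwist)

lemma exp_hat_0: "exp_hat 0 x \<doteq> seq_unit"
  unfolding seq_eq_def eq_mod_nu_def
  by (auto simp: seq_unit_def coeff_exp_hat coeff_pCons split: nat.splits)

lemma seq_antipode_exp_hat: "seq_antipode (exp_hat s x) \<doteq> exp_hat (- s) x"
  unfolding seq_eq_def eq_mod_nu_def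
  by (simp add: seq_antipode_def coeff_map_poly linear_0[OF linear_uea_antipode] coeff_exp_hat
      linear_scale[OF linear_uea_antipode] uea_antipode_hom_power power_minus[of s])

lemma exp_hat_vee_neg: "exp_hat s x \<squnion>\<^sub>G exp_hat (- s) x \<doteq> seq_unit"
proof -
  have "seq_alpha (exp_hat 0 x) \<doteq> seq_unit"
    unfolding seq_eq_def eq_mod_nu_def
    by (auto simp: seq_unit_def seq_alpha_def coeff_map_poly linear_0[OF linear_uea_alpha] coeff_exp_hat
       coeff_pCons uea_alpha_unit split: nat.splits)
  then show ?thesis
    using seq_vee_exp_hat[of s x "- s"] by (simp add: seq_eq_def eq_mod_nu_def)
qed

text \<open>
  The convolution of two maps that scale the \<open>n\<close>-th power by \<open>a\<^sup>n\<close> and \<open>b\<^sup>n\<close>.  For the antipode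
  and the identity these factors are \<open>(-1)\<^sup>n\<close> and \<open>1\<close>.
\<close>

lemma tensor_lift_vee_hom_power:
  assumes "linear f" "linear h" "k \<le> Suc q"
    and f: "\<And>n. n \<le> Suc q \<Longrightarrow> f (hom_power x n q) = a ^ n *\<^sub>R hom_power x n q"
    and h: "\<And>n. n \<le> Suc q \<Longrightarrow> h (hom_power x n q) = b ^ n *\<^sub>R hom_power x n q"
  shows "tensor_lift uea_vee (tensor_map f h (uea_comult (hom_power x k q))) = (a + b) ^ k *\<^sub>R hom_power x k (Suc q)"
proof -
  note tl = linear_tensor_lift[OF bilinear_uea_vee] and tm = linear_tensor_map[OF assms(1,2)]
  have "tensor_lift uea_vee (tensor_map f h (uea_comult (hom_power x k q)))
      = (\<Sum>i\<le>k. real (k choose i) *\<^sub>R uea_vee (f (hom_power x i q)) (h (hom_power x (k - i) q)))"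
    by (simp add: uea_comult_hom_power assms linear_sum[OF tl] linear_sum[OF tm] linear_scale[OF tl]
      linear_scale[OF tm] tensor_map_tensor tensor_lift_tensor[OF bilinear_uea_vee])
  also have "\<dots> = (\<Sum>i\<le>k. (real (k choose i) * a ^ i * b ^ (k - i)) *\<^sub>R hom_power x k (Suc q))"
  proof (intro sum.cong refl)
    fix i assume i: "i \<in> {..k}"
    then have "uea_vee (hom_power x i q) (hom_power x (k - i) q) = hom_power x (i + (k - i)) (Suc q)"
      using assms(3) by (intro hom_power_vee) auto
    then show "real (k choose i) *\<^sub>R uea_vee (f (hom_power x i q)) (h (hom_power x (k - i) q))
      = (real (k choose i) * a ^ i * b ^ (k - i)) *\<^sub>R hom_power x k (Suc q)"
      using i assms(3) by (simp add: f h bilinear_lmul[OF bilinear_uea_vee] bilinear_rmul[OF bilinear_uea_vee])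
  qed
  also have "\<dots> = (a + b) ^ k *\<^sub>R hom_power x k (Suc q)"
    unfolding scaleR_sum_left[symmetric] binomial_ring by simp
  finally show ?thesis .
qed

lemma invertible_at_exp_hat: "invertible_at 0 (exp_hat s x p)"
proof -
  have *: "map_poly (tensor_lift uea_vee \<circ> tensor_map f h \<circ> uea_comult) (exp_hat s x p)
      = map_poly (\<lambda>u. uea_counit u *\<^sub>R uea_unit) (exp_hat s x p)"
    if lin: "linear f" "linear h" and ab: "a + b = 0"
      and f: "\<And>n. n \<le> Suc (p - 1) \<Longrightarrow> f (hom_power x n (p - 1)) = a ^ n *\<^sub>R hom_power x n (p - 1)"
      and h: "\<And>n. n \<le> Suc (p - 1) \<Longrightarrow> h (hom_power x n (p - 1)) = b ^ n *\<^sub>R hom_power x n (p - 1)"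
    for f h :: "'a uea \<Rightarrow> 'a uea" and a b :: real
  proof (rule poly_eqI)
    fix k
    have F: "linear (\<lambda>u. tensor_lift uea_vee (tensor_map f h (uea_comult u)))"
      by (rule linear_compose_fun[OF linear_tensor_lift[OF bilinear_uea_vee]
          linear_compose_fun[OF linear_tensor_map[OF lin] linear_uea_comult]])
    have hp: "tensor_lift uea_vee (tensor_map f h (uea_comult (hom_power x k (p - 1)))) = 0 ^ k *\<^sub>R hom_power x k (Suc (p - 1))"
      if "k \<le> p"
      using tensor_lift_vee_hom_power[OF lin _ f h, of k] that by (simp add: ab)
    show "coeff (map_poly (tensor_lift uea_vee \<circ> tensor_map f h \<circ> uea_comult) (exp_hat s x p)) k
      = coeff (map_poly (\<lambda>u. uea_counit u *\<^sub>R uea_unit) (exp_hat s x p)) k"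
      using hp linear_0[OF F]
      by (simp add: coeff_map_poly linear_0[OF linear_uea_counit] coeff_exp_hat linear_scale[OF F]
         linear_scale[OF linear_uea_counit] uea_counit_hom_power)
  qed
  (* Already the zeroth iterate of alpha works: the scaling factors add up to 0. *)
  show ?thesis
    unfolding invertible_at_def
    using *[of uea_antipode id "-1" 1] *[of id uea_antipode 1 "-1"]
    by (simp add: linear_uea_antipode uea_antipode_hom_power linear_id comp_assoc[symmetric])
qed

lemma exp_hat_in_G_seq: "exp_hat s x \<in> G_seq"
proof -
  have "eq_mod_nu (p + 1) (exp_hat s x (p + 1)) (map_poly uea_alpha (exp_hat s x p))" for p
    unfolding eq_mod_nu_def
  proof (intro allI impI)
    fix k assume "k < p + 1"
    then show "coeff (exp_hat s x (p + 1)) k = coeff (map_poly uea_alpha (exp_hat s x p)) k"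
      by (cases p) (simp_all add: coeff_map_poly linear_0[OF linear_uea_alpha] coeff_exp_hat
        linear_scale[OF linear_uea_alpha] uea_alpha_hom_power uea_alpha_unit)
  qed
  moreover have "invertibility_index (exp_hat s x p) \<le> enat 0" for p
    unfolding invertibility_index_def by (rule INF_lower) (simp add: invertible_at_exp_hat)
  ultimately show ?thesis
    unfolding G_seq_def using group_like_exp_hat by blast
qed

theorem theorem5p4:
  fixes x :: "'g::hom_lie_algebra"
  shows "(\<forall>s. exp_hat s x \<in> G_seq)
    \<and> exp_hat 0 x \<doteq> seq_unit
    \<and> (\<forall>s t. exp_hat s x \<squnion>\<^sub>G exp_hat t x \<doteq> seq_alpha (exp_hat (s + t) x)
         \<and> seq_alpha (exp_hat (s + t) x) \<doteq> exp_hat (s + t) (htwist x))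
    \<and> (\<forall>s. seq_antipode (exp_hat s x) \<doteq> exp_hat (- s) x
         \<and> exp_hat s x \<squnion>\<^sub>G exp_hat (- s) x \<doteq> seq_unit
         \<and> exp_hat (- s) x \<squnion>\<^sub>G exp_hat s x \<doteq> seq_unit)"
  using exp_hat_in_G_seq exp_hat_0 seq_vee_exp_hat seq_alpha_exp_hat seq_antipode_exp_hat
    exp_hat_vee_neg exp_hat_vee_neg[of "- s" for s] by auto

end
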